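(* Let $\mathcal{E}(t)$ be the semidiscrete solution matrix of the lumped mass (LM) approximation. Then $\mathcal{E}(t)\ge0$ (elementwise) for all $t\ge0$ if and only if the triangulation $\mathcal{T}_h$ is Delaunay.
   Context: Fractional operator. $P(\partial_t)u(t)=\int_0^1\partial_t^\alpha u(t)\,d\nu(\alpha)$, where $\partial_t^\alpha$ is the Caputo derivative $\partial_t^\alpha u(t)=\frac{1}{\Gamma(1-\alpha)}\int_0^t(t-s)^{-\alpha}u'(s)\,ds$. One of two cases is assumed, with characteristic function $P(z)=\int_0^1z^\alpha d\nu(\alpha)$. Case I: $P(z)=\sum_{i=1}^m b_iz^{\alpha_i}$, $m\ge1$, $0<\alpha_m<\dots<\alpha_1<1$, $b_i>0$, $b_1=1$. Case II: $P(z)=\int_0^1z^\alpha\mu(\alpha)\,d\alpha$, with $\mu\ge0$ Hölder continuous on $[0,1]$ and $\mu(0)\mu(1)>0$. Finite elements. $\Omega\subset\mathbb{R}^2$ is a bounded polygonal domain, $\mathcal{T}_h$ a triangulation of $\Omega$ (from a shape regular quasi-uniform family), $X_h\subset H_0^1(\Omega)$ the space of continuous functions that are linear on each triangle of $\mathcal{T}_h$ and vanish on $\partial\Omega$. $P_1,\dots,P_N$ are the interior nodes and $\phi_1,\dots,\phi_N$ the corresponding nodal basis. The stiffness matrix is $\mathcal{S}=(s_{ij})$, $s_{ij}=\int_\Omega\nabla\phi_j\cdot\nabla\phi_i\,dx$. In the LM method the mass matrix is $\mathcal{M}=(m_{ij})$, $m_{ij}=[\phi_j,\phi_i]$, with $[w,\chi]=\sum_{K\in\mathcal{T}_h}\frac13|K|\sum_{l=1}^3(w\chi)(P_l^K)$,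 where $P_1^K,P_2^K,P_3^K$ are the vertices of $K$ and $|K|$ its area; thus $\mathcal{M}$ is diagonal with positive diagonal. Set $\mathcal{H}=\mathcal{M}^{-1}\mathcal{S}$. Delaunay. An edge $e$ of $\mathcal{T}_h$ is called a Delaunay edge if the sum of the angles $\psi_1$ and $\psi_2$ opposite $e$ is $\le\pi$. $\mathcal{T}_h$ is a Delaunay triangulation if all interior edges are Delaunay. Semidiscrete solution matrix. $\mathcal{E}(t)$ is the matrix such that $U(t)=\mathcal{E}(t)V$ solves $P(\partial_t)U(t)+\mathcal{H}U(t)=0$ for $t>0$, $U(0)=V$. Equivalently, $\mathcal{E}$ has Laplace transform $z^{-1}P(z)(P(z)\mathcal{I}+\mathcal{H})^{-1}$, where $\mathcal{I}$ is the identity matrix.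
   Formalization: "Interior edges" in the Delaunay condition are taken to be edges joining two interior nodes; if edges with an endpoint on the boundary also had to be Delaunay, the "only if" direction would be false (for example with a single interior node). *)

theory Defs
  imports "HOL-Analysis.Analysis"
begin

section \<open>Triangulations of a polygonal domain\<close>

text \<open>
  The condition \<open>interior (closure \<Omega>) = \<Omega>\<close> excludes domains with cracks or punctures.
\<close>

definition polygonal_domain :: "(real^2) set \<Rightarrow> bool" where
  "polygonal_domain \<Omega> \<longleftrightarrow>
     open \<Omega> \<and> connected \<Omega> \<and> bounded \<Omega> \<and> \<Omega> \<noteq> {} \<and> interior (closure \<Omega>) = \<Omega> \<and>
     (\<exists>L. finite L \<and> frontier \<Omega> = (\<Union>(a, b)\<in>L. closed_segment a b))"

text \<open>
  Triangles are closed. The library predicate \<^const>\<open>triangulation\<close> says that any two members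
  meet in a common (possibly empty) face, but it allows simplices of any dimension.
\<close>

definition triangulates :: "(real^2) set set \<Rightarrow> (real^2) set \<Rightarrow> bool" where
  "triangulates \<T> \<Omega> \<longleftrightarrow> triangulation \<T> \<and> (\<forall>K\<in>\<T>. 2 simplex K) \<and> \<Union>\<T> = closure \<Omega>"

definition mesh_size :: "(real^2) set set \<Rightarrow> real" where
  "mesh_size \<T> = Max (diameter ` \<T>)"

definition shape_regular_quasi_uniform :: "(real^2) set set set \<Rightarrow> bool" where
  "shape_regular_quasi_uniform \<FF> \<longleftrightarrow>
     (\<exists>c>0. \<forall>\<T>\<in>\<FF>. \<forall>K\<in>\<T>.
        (\<exists>x. ball x (c * diameter K) \<subseteq> K) \<and> c * mesh_size \<T> \<le> diameter K)"

definition vertices :: "(real^2) set \<Rightarrow> (real^2) set" where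
  "vertices K = {v. v extreme_point_of K}"

definition interior_nodes :: "(real^2) set set \<Rightarrow> (real^2) set \<Rightarrow> (real^2) set" where
  "interior_nodes \<T> \<Omega> = (\<Union>K\<in>\<T>. vertices K) \<inter> \<Omega>"

text \<open>
  As for nodes, an edge is interior if it lies in the open set \<open>\<Omega>\<close>. Edges are closed segments
  with their endpoints, so an edge that reaches the boundary at an endpoint is not interior.
  No entry of the stiffness matrix corresponds to such an edge.
\<close>

definition interior_edges :: "(real^2) set set \<Rightarrow> (real^2) set \<Rightarrow> (real^2) set set" where
  "interior_edges \<T> \<Omega> = {e. (\<exists>K\<in>\<T>. e edge_of K) \<and> e \<subseteq> \<Omega>}"

text \<open>The angle at \<open>b\<close> between the rays towards \<open>a\<close> and \<open>c\<close>.\<close>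

definition angle :: "real^2 \<Rightarrow> real^2 \<Rightarrow> real^2 \<Rightarrow> real" where
  "angle a b c = arccos ((a - b) \<bullet> (c - b) / (norm (a - b) * norm (c - b)))"

definition Delaunay_edge :: "(real^2) set set \<Rightarrow> (real^2) set \<Rightarrow> bool" where
  "Delaunay_edge \<T> e \<longleftrightarrow>
     (\<forall>a b c d. e = closed_segment a b \<and> c \<noteq> d \<and>
        convex hull {a, b, c} \<in> \<T> \<and> convex hull {a, b, d} \<in> \<T>
        \<longrightarrow> angle a c b + angle a d b \<le> pi)"

definition Delaunay :: "(real^2) set set \<Rightarrow> (real^2) set \<Rightarrow> bool" where
  "Delaunay \<T> \<Omega> \<longleftrightarrow> (\<forall>e\<in>interior_edges \<T> \<Omega>. Delaunay_edge \<T> e)"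


section \<open>Finite element matrices\<close>

text \<open>
  Members of \<open>X\<^sub>h\<close> are functions on the whole plane; their values outside \<open>closure \<Omega>\<close> are
  unconstrained and never used.
\<close>

definition fe_space :: "(real^2) set set \<Rightarrow> (real^2) set \<Rightarrow> (real^2 \<Rightarrow> real) set" where
  "fe_space \<T> \<Omega> =
     {w. continuous_on (closure \<Omega>) w \<and>
         (\<forall>K\<in>\<T>. \<exists>g c. \<forall>x\<in>K. w x = g \<bullet> x + c) \<and>
         (\<forall>x\<in>frontier \<Omega>. w x = 0)}"

definition nodal_basis ::
  "(real^2) set set \<Rightarrow> (real^2) set \<Rightarrow> ('n \<Rightarrow> real^2) \<Rightarrow> ('n \<Rightarrow> real^2 \<Rightarrow> real) \<Rightarrow> bool" where
  "nodal_basis \<T> \<Omega> P \<phi> \<longleftrightarrow>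
     (\<forall>i. \<phi> i \<in> fe_space \<T> \<Omega>) \<and> (\<forall>i j. \<phi> i (P j) = (if i = j then 1 else 0))"

text \<open>
  For a piecewise linear function the classical gradient exists off the edges, which form a null
  set, and there it agrees with the weak gradient.
\<close>

definition gradient :: "(real^2 \<Rightarrow> real) \<Rightarrow> real^2 \<Rightarrow> real^2" where
  "gradient w x = (THE g. GDERIV w x :> g)"

definition stiffness_matrix ::
  "(real^2) set \<Rightarrow> ('n::finite \<Rightarrow> real^2 \<Rightarrow> real) \<Rightarrow> real^'n^'n" where
  "stiffness_matrix \<Omega> \<phi> =
     (\<chi> i j. set_lebesgue_integral lebesgue \<Omega> (\<lambda>x. gradient (\<phi> j) x \<bullet> gradient (\<phi> i) x))"

definition lumped_product ::
  "(real^2) set set \<Rightarrow> (real^2 \<Rightarrow> real) \<Rightarrow> (real^2 \<Rightarrow> real) \<Rightarrow> real" where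
  "lumped_product \<T> w v =
     (\<Sum>K\<in>\<T>. 1/3 * measure lebesgue K * (\<Sum>p\<in>vertices K. w p * v p))"

definition lumped_mass_matrix ::
  "(real^2) set set \<Rightarrow> ('n::finite \<Rightarrow> real^2 \<Rightarrow> real) \<Rightarrow> real^'n^'n" where
  "lumped_mass_matrix \<T> \<phi> = (\<chi> i j. lumped_product \<T> (\<phi> j) (\<phi> i))"

definition LM_matrix ::
  "(real^2) set set \<Rightarrow> (real^2) set \<Rightarrow> ('n::finite \<Rightarrow> real^2 \<Rightarrow> real) \<Rightarrow> real^'n^'n" where
  "LM_matrix \<T> \<Omega> \<phi> = matrix_inv (lumped_mass_matrix \<T> \<phi>) ** stiffness_matrix \<Omega> \<phi>"


section \<open>The fractional operator\<close>

text \<open>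
  At \<open>\<alpha> = 1\<close> the value below is 0, since \<^term>\<open>Gamma (0::real)\<close> is 0 in the library. Neither
  kind of admissible measure charges that point.
\<close>

definition caputo :: "real \<Rightarrow> (real \<Rightarrow> real) \<Rightarrow> real \<Rightarrow> real" where
  "caputo \<alpha> u t =
     1 / Gamma (1 - \<alpha>) * set_lebesgue_integral lborel {0..t} (\<lambda>s. (t - s) powr (-\<alpha>) * deriv u s)"

definition frac_op :: "real measure \<Rightarrow> (real \<Rightarrow> real) \<Rightarrow> real \<Rightarrow> real" where
  "frac_op \<nu> u t = integral\<^sup>L \<nu> (\<lambda>\<alpha>. caputo \<alpha> u t)"

text \<open>
  For \<open>\<alpha>\<close> injective on \<open>{1..m}\<close> this is the sum of the point masses \<open>b i\<close> at \<open>\<alpha> i\<close>.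
\<close>

definition multi_term_measure :: "nat \<Rightarrow> (nat \<Rightarrow> real) \<Rightarrow> (nat \<Rightarrow> real) \<Rightarrow> real measure" where
  "multi_term_measure m b \<alpha> =
     point_measure (\<alpha> ` {1..m}) (\<lambda>a. ennreal (b (inv_into {1..m} \<alpha> a)))"

definition case_I :: "real measure \<Rightarrow> bool" where
  "case_I \<nu> \<longleftrightarrow>
     (\<exists>m b \<alpha>. m \<ge> 1 \<and> (\<forall>i\<in>{1..m}. 0 < \<alpha> i \<and> \<alpha> i < 1) \<and>
        (\<forall>i\<in>{1..m}. \<forall>j\<in>{1..m}. i < j \<longrightarrow> \<alpha> j < \<alpha> i) \<and>
        (\<forall>i\<in>{1..m}. b i > 0) \<and> b 1 = 1 \<and> \<nu> = multi_term_measure m b \<alpha>)"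

definition case_II :: "real measure \<Rightarrow> bool" where
  "case_II \<nu> \<longleftrightarrow>
     (\<exists>\<mu>::real \<Rightarrow> real. (\<forall>a\<in>{0..1}. \<mu> a \<ge> 0) \<and>
        (\<exists>C \<theta>. 0 < \<theta> \<and> \<theta> \<le> 1 \<and>
           (\<forall>x\<in>{0..1}. \<forall>y\<in>{0..1}. \<bar>\<mu> x - \<mu> y\<bar> \<le> C * \<bar>x - y\<bar> powr \<theta>)) \<and>
        \<mu> 0 * \<mu> 1 > 0 \<and>
        \<nu> = density (restrict_space lborel {0..1}) (\<lambda>a. ennreal (\<mu> a)))"

lemma frac_op_multi_term:
  assumes "inj_on \<alpha> {1..m}" "\<And>i. i \<in> {1..m} \<Longrightarrow> b i > 0"
  shows "frac_op (multi_term_measure m b \<alpha>) u t = (\<Sum>i=1..m. b i * caputo (\<alpha> i) u t)"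
proof -
  have "frac_op (multi_term_measure m b \<alpha>) u t =
      (\<Sum>a\<in>\<alpha> ` {1..m}. b (inv_into {1..m} \<alpha> a) * caputo a u t)"
    unfolding frac_op_def multi_term_measure_def
    using assms by (subst lebesgue_integral_point_measure_finite)
      (auto simp: inv_into_f_f intro: less_imp_le)
  also have "\<dots> = (\<Sum>i=1..m. b i * caputo (\<alpha> i) u t)"
    using assms(1) by (subst sum.reindex) (auto simp: inv_into_f_f)
  finally show ?thesis .
qed


section \<open>The semidiscrete solution matrix\<close>

text \<open>
  The natural class for the Caputo derivative. Solutions are in general not differentiable
  at \<open>t = 0\<close>, but their derivative is integrable there.
\<close>

definition caputo_class :: "(real \<Rightarrow> real) set" where
  "caputo_class =
     {u. continuous_on {0..} u \<and> (\<forall>t>0. u field_differentiable (at t)) \<and>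
         continuous_on {0<..} (deriv u) \<and> (\<forall>t>0. set_integrable lborel {0..t} (deriv u))}"

definition solves_ivp ::
  "real measure \<Rightarrow> real^'n^'n \<Rightarrow> real^'n \<Rightarrow> (real \<Rightarrow> real^'n::finite) \<Rightarrow> bool" where
  "solves_ivp \<nu> H V U \<longleftrightarrow>
     (\<forall>i. (\<lambda>t. U t $ i) \<in> caputo_class) \<and>
     (\<forall>t>0. (\<chi> i. frac_op \<nu> (\<lambda>s. U s $ i) t) + H *v U t = 0) \<and>
     U 0 = V"

definition solution_matrix ::
  "real measure \<Rightarrow> real^'n^'n \<Rightarrow> (real \<Rightarrow> real^'n^'n::finite) \<Rightarrow> bool" where
  "solution_matrix \<nu> H E \<longleftrightarrow> (\<forall>V. solves_ivp \<nu> H V (\<lambda>t. E t *v V))"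

end

theory Submission
  imports Defs
begin

text \<open>
  Let \<open>H = M\<^sup>-\<^sup>1 S\<close>. At a positive time where \<open>u\<close> attains its maximum so far, every Caputo
  derivative of order in \<open>[0, 1]\<close> is nonnegative. This extremum principle gives both halves of
  the claim that \<open>E(t) \<ge> 0\<close> for all \<open>t\<close> iff the off-diagonal entries of \<open>H\<close> are nonpositive. If \<open>H\<^sub>i\<^sub>j > 0\<close>, the
  equation forces \<open>P(\<partial>\<^sub>t) E\<^sub>i\<^sub>j < 0\<close> near \<open>t = 0\<close>, although \<open>E\<^sub>i\<^sub>j\<close> rises from its minimum 0.
  Conversely, a Stieltjes matrix \<open>S\<close> has \<open>w > 0\<close> with \<open>S w = 1\<close>, and a negative minimum of
  \<open>u\<^sub>i / w\<^sub>i\<close> over space and time would contradict the equation.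

  The entry \<open>S\<^sub>i\<^sub>j\<close> is \<open>-1/2\<close> times the sum of the cotangents of the angles opposite the edge
  \<open>P\<^sub>i P\<^sub>j\<close>, and \<open>cot \<psi>\<^sub>1 + cot \<psi>\<^sub>2 \<ge> 0\<close> iff \<open>\<psi>\<^sub>1 + \<psi>\<^sub>2 \<le> \<pi>\<close>.
\<close>


section \<open>Extremum principle for the fractional operator\<close>

text \<open>Integration by parts against \<open>v s - v t\<close>, which is nonpositive: as the
  kernel is nondecreasing in \<open>s\<close>, the integrand dominates the derivative of
  \<open>F\<close>. The boundary term at the left end has a favourable sign, and the one at
  \<open>t\<close> tends to 0 because the order is below 1.\<close>

lemma convolution_derivative_nonneg_at_max:
  fixes v v' :: "real \<Rightarrow> real"
  assumes t: "t > 0" and \<alpha>: "0 \<le> \<alpha>" "\<alpha> < 1"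
    and der: "\<And>s. 0 < s \<Longrightarrow> s \<le> t \<Longrightarrow> (v has_real_derivative v' s) (at s)"
    and cont: "continuous_on {0<..} v'"
    and max: "\<And>s. 0 \<le> s \<Longrightarrow> s \<le> t \<Longrightarrow> v s \<le> v t"
  shows "set_lebesgue_integral lborel {0..t} (\<lambda>s. (t - s) powr (-\<alpha>) * v' s) \<ge> 0"
proof (cases "set_integrable lborel {0..t} (\<lambda>s. (t - s) powr (-\<alpha>) * v' s)")
  case False
  \<comment> \<open>The integral of a non-integrable function is 0 by convention.\<close>
  then show ?thesis
    by (simp add: set_integrable_def set_lebesgue_integral_def not_integrable_integral_eq)
next
  case True
  define f where "f = (\<lambda>s. (t - s) powr (-\<alpha>) * v' s)"
  define F where "F = (\<lambda>s. (t - s) powr (-\<alpha>) * (v s - v t))"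
  define F' where "F' = (\<lambda>s. (t - s) powr (-\<alpha>) * v' s + \<alpha> * (t - s) powr (-\<alpha> - 1) * (v s - v t))"
  have lower: "F y \<le> set_lebesgue_integral lborel {x..y} f" if "0 < x" "x \<le> y" "y < t" for x y
  proof -
    have dF: "(F has_real_derivative F' s) (at s)" if "s \<in> {x..y}" for s
      unfolding F_def F'_def
      by (rule derivative_eq_intros der | use that \<open>0 < x\<close> \<open>y < t\<close> in force)+
    have cf: "continuous_on {x..y} f" unfolding f_def
      by (intro continuous_intros continuous_on_subset[OF cont]) (use that in auto)
    have FI: "(F' has_integral (F y - F x)) {x..y}"
      by (rule fundamental_theorem_of_calculus)
        (use dF that in \<open>auto simp: has_real_derivative_iff_has_vector_derivative[symmetric] intro: has_field_derivative_at_within\<close>)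
    have "F y - F x \<le> integral {x..y} f"
    proof (rule has_integral_le[OF FI integrable_integral])
      show "f integrable_on {x..y}" using cf by (rule integrable_continuous_real)
      show "F' s \<le> f s" if "s \<in> {x..y}" for s
        unfolding F'_def f_def using max[of s] that \<open>0 < x\<close> \<open>y < t\<close> \<alpha>
        by (auto intro!: mult_nonneg_nonpos)
    qed
    moreover have "F x \<le> 0"
      unfolding F_def using max[of x] that by (auto intro!: mult_nonneg_nonpos)
    moreover have "set_integrable lborel {x..y} f"
      using borel_integrable_atLeastAtMost'[OF cf] .
    ultimately show ?thesis by (simp add: set_borel_integral_eq_integral)
  qed
  \<comment> \<open>The intervals \<open>{x n..t - x n}\<close> avoid both singular ends, the
    derivative at 0 and the kernel at \<open>t\<close>; the summand 2 keeps them nonempty already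
    for \<open>n = 0\<close>.\<close>
  define x where "x = (\<lambda>n. t / (real n + 2))"
  have xlim: "x \<longlonglongrightarrow> 0" unfolding x_def
    by (rule real_tendsto_divide_at_top[OF tendsto_const])
      (rule filterlim_at_top_mono[OF filterlim_real_sequentially], simp)
  have x0: "0 < x n" "x n \<le> t - x n" "t - x n < t" for n
    using t by (auto simp: x_def field_simps)
  have Un: "(\<Union>n. {x n..t - x n}) = {0<..<t}"
  proof (intro equalityI subsetI)
    fix s assume s: "s \<in> {0<..<t}"
    have "eventually (\<lambda>n. x n < min s (t - s)) sequentially"
      using xlim s by (intro order_tendstoD) auto
    then obtain n where "x n < min s (t - s)" by (auto simp: eventually_sequentially)
    then show "s \<in> (\<Union>n. {x n..t - x n})" by (intro UN_I[of n]) auto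
  next
    fix s assume "s \<in> (\<Union>n. {x n..t - x n})"
    then obtain n where "x n \<le> s" "s \<le> t - x n" by auto
    then show "s \<in> {0<..<t}" using x0[of n] by auto
  qed
  have inc: "incseq (\<lambda>n. {x n..t - x n})"
  proof -
    have "x n \<le> x m" if "m \<le> n" for m n
      using t that unfolding x_def by (intro divide_left_mono) auto
    then show ?thesis by (fastforce simp: incseq_def)
  qed
  have fi: "set_integrable lborel (\<Union>n. {x n..t - x n}) f"
    using True unfolding Un f_def by (rule set_integrable_subset) auto
  have lim1: "(\<lambda>n. set_lebesgue_integral lborel {x n..t - x n} f) \<longlonglongrightarrow> set_lebesgue_integral lborel {0<..<t} f"
    using set_integral_cont_up[OF _ inc fi] unfolding Un by auto
  \<comment> \<open>\<open>F (t - x n)\<close> is minus the difference quotient at \<open>t\<close>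
    times \<open>x n powr (1 - \<alpha>)\<close>. The quotient converges and the power tends to 0,
    the order being below 1.\<close>
  have lim2: "(\<lambda>n. F (t - x n)) \<longlonglongrightarrow> 0"
  proof -
    have "((\<lambda>y. (v y - v t) / (y - t)) \<longlongrightarrow> v' t) (at t)"
      using der[of t] t by (simp add: has_field_derivative_iff)
    moreover have "filterlim (\<lambda>n. t - x n) (at t) sequentially"
      using tendsto_diff[OF tendsto_const[of t] xlim] less_imp_neq[OF x0(3)]
      by (simp add: filterlim_at)
    ultimately have "(\<lambda>n. (v (t - x n) - v t) / (t - x n - t)) \<longlonglongrightarrow> v' t"
      by (rule filterlim_compose)
    moreover have "(\<lambda>n. x n powr (1 - \<alpha>)) \<longlonglongrightarrow> 0"
      using tendsto_powr'[OF xlim tendsto_const[of "1 - \<alpha>"]] \<alpha> x0 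
      by (auto simp: less_imp_le)
    ultimately have "(\<lambda>n. - (x n powr (1 - \<alpha>) * ((v (t - x n) - v t) / (t - x n - t)))) \<longlonglongrightarrow> - (0 * v' t)"
      by (intro tendsto_intros)
    moreover have "- (x n powr (1 - \<alpha>) * ((v (t - x n) - v t) / (t - x n - t))) = F (t - x n)" for n
      using x0[of n] unfolding F_def by (simp add: powr_diff powr_minus field_simps)
    ultimately show ?thesis by simp
  qed
  have "0 \<le> set_lebesgue_integral lborel {0<..<t} f"
    by (rule LIMSEQ_le[OF lim2 lim1]) (use lower x0 in blast)
  also have "\<dots> = set_lebesgue_integral lborel {0..t} f"
  proof -
    have "AE s in lborel. s \<noteq> 0 \<and> s \<noteq> t"
      using AE_lborel_singleton[of 0] AE_lborel_singleton[of t] by eventually_elim auto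
    moreover have "set_borel_measurable lborel {0<..<t} f" "set_borel_measurable lborel {0..t} f"
      using fi True unfolding Un f_def
      by (auto simp: set_integrable_def set_borel_measurable_def)
    ultimately show ?thesis by (intro set_integral_cong_set) auto
  qed
  finally show ?thesis by (simp add: f_def)
qed

text \<open>The minimum case is the maximum case for \<open>- u\<close>. At order 1 both hold
  trivially, since \<open>Gamma 0\<close> and hence \<open>1 / Gamma 0\<close> are 0 by
  convention.\<close>

lemma caputo_extremum:
  assumes u: "u \<in> caputo_class" and t: "t > 0" and \<alpha>: "\<alpha> \<in> {0..1}"
  shows caputo_nonneg_at_max: "(\<And>s. 0 \<le> s \<Longrightarrow> s \<le> t \<Longrightarrow> u s \<le> u t) \<Longrightarrow> caputo \<alpha> u t \<ge> 0"
    and caputo_nonpos_at_min: "(\<And>s. 0 \<le> s \<Longrightarrow> s \<le> t \<Longrightarrow> u t \<le> u s) \<Longrightarrow> caputo \<alpha> u t \<le> 0"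
proof -
  have der: "(u has_real_derivative deriv u s) (at s)" if "0 < s" for s
    using u that by (auto simp: caputo_class_def field_differentiable_derivI)
  have cont: "continuous_on {0<..} (deriv u)"
    using u by (simp add: caputo_class_def)
  let ?I = "set_lebesgue_integral lborel {0..t} (\<lambda>s. (t - s) powr (-\<alpha>) * deriv u s)"
  have G: "Gamma (1 - \<alpha>) \<ge> 0"
    using \<alpha> Gamma_real_pos[of "1 - \<alpha>"] by (cases "\<alpha> = 1") auto
  {
    assume max: "\<And>s. 0 \<le> s \<Longrightarrow> s \<le> t \<Longrightarrow> u s \<le> u t"
    have "\<alpha> < 1 \<Longrightarrow> ?I \<ge> 0"
      using convolution_derivative_nonneg_at_max[of t \<alpha> u "deriv u"] der cont max t \<alpha> by auto
    then show "caputo \<alpha> u t \<ge> 0" 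
      using G \<alpha> by (cases "\<alpha> = 1") (auto simp: caputo_def)
  next
    assume min: "\<And>s. 0 \<le> s \<Longrightarrow> s \<le> t \<Longrightarrow> u t \<le> u s"
    have "set_lebesgue_integral lborel {0..t} (\<lambda>s. (t - s) powr (-\<alpha>) * - deriv u s) \<ge> 0" if "\<alpha> < 1"
      using min t \<alpha> that by (intro convolution_derivative_nonneg_at_max[where v = "\<lambda>s. - u s"])
        (auto intro!: derivative_eq_intros der cont continuous_intros)
    then have "\<alpha> < 1 \<Longrightarrow> ?I \<le> 0"
      by (simp add: set_lebesgue_integral_def)
    then show "caputo \<alpha> u t \<le> 0" 
      using G \<alpha> by (cases "\<alpha> = 1") (auto simp: caputo_def divide_le_0_iff)
  }
qed

text \<open>The sign is inherited pointwise in the order; the integral of a nonnegative function is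
  nonnegative even by the convention for non-integrable ones.\<close>

lemma frac_op_extremum:
  assumes u: "u \<in> caputo_class" and t: "t > 0" and \<nu>: "space \<nu> \<subseteq> {0..1}"
  shows frac_op_nonneg_at_max: "(\<And>s. 0 \<le> s \<Longrightarrow> s \<le> t \<Longrightarrow> u s \<le> u t) \<Longrightarrow> frac_op \<nu> u t \<ge> 0"
    and frac_op_nonpos_at_min: "(\<And>s. 0 \<le> s \<Longrightarrow> s \<le> t \<Longrightarrow> u t \<le> u s) \<Longrightarrow> frac_op \<nu> u t \<le> 0"
proof -
  assume max: "\<And>s. 0 \<le> s \<Longrightarrow> s \<le> t \<Longrightarrow> u s \<le> u t"
  show "frac_op \<nu> u t \<ge> 0" unfolding frac_op_def
    by (intro Bochner_Integration.integral_nonneg caputo_nonneg_at_max[OF u t]) (use max \<nu> in auto)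
next
  assume min: "\<And>s. 0 \<le> s \<Longrightarrow> s \<le> t \<Longrightarrow> u t \<le> u s"
  have "integral\<^sup>L \<nu> (\<lambda>\<alpha>. - caputo \<alpha> u t) \<ge> 0"
    using caputo_nonpos_at_min[OF u t] min \<nu>
    by (intro Bochner_Integration.integral_nonneg) auto
  then show "frac_op \<nu> u t \<le> 0" by (simp add: frac_op_def)
qed

text \<open>This inclusion and the next let one argument cover both kinds of measure.\<close>

lemma space_case_I: "case_I \<nu> \<Longrightarrow> space \<nu> \<subseteq> {0..1}"
  by (force simp: case_I_def multi_term_measure_def space_point_measure)

lemma space_case_II: "case_II \<nu> \<Longrightarrow> space \<nu> \<subseteq> {0..1}"
  by (auto simp: case_II_def space_restrict_space)

section \<open>Sign of solutions of the fractional system\<close>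

lemma solves_ivp_component:
  assumes "solves_ivp \<nu> H V U" "t > 0"
  shows "frac_op \<nu> (\<lambda>s. U s $ i) t + (\<Sum>k\<in>UNIV. H $ i $ k * U t $ k) = 0"
proof -
  have "((\<chi> i. frac_op \<nu> (\<lambda>s. U s $ i) t) + H *v U t) $ i = 0"
    using assms by (simp add: solves_ivp_def)
  then show ?thesis by (simp add: matrix_vector_mult_def)
qed

text \<open>At a negative minimum \<open>m\<close> of \<open>U t $ k / w $ k\<close> over
  \<open>k\<close> and \<open>t\<close>, attained in component \<open>i\<close>, row
  \<open>i\<close> of \<open>H U\<close> is at most \<open>m\<close> times row \<open>i\<close> of
  \<open>H w\<close>, hence negative, while the fractional operator is nonpositive; so they cannot
  add up to 0. The weight \<open>w\<close> makes up for row sums of \<open>H\<close> that need not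
  be positive.\<close>

lemma solves_ivp_nonneg:
  fixes H :: "real^'n^'n::finite"
  assumes \<nu>: "space \<nu> \<subseteq> {0..1}" and U: "solves_ivp \<nu> H V U"
    and V: "\<And>i. V $ i \<ge> 0" and H: "\<And>i k. i \<noteq> k \<Longrightarrow> H $ i $ k \<le> 0"
    and w: "\<And>i. w $ i > 0" and Hw: "\<And>i. (H *v w) $ i > 0"
    and T: "T \<ge> 0"
  shows "U T $ i\<^sub>0 \<ge> 0"
proof (rule ccontr)
  assume neg: "\<not> U T $ i\<^sub>0 \<ge> 0"
  have cls: "(\<lambda>t. U t $ i) \<in> caputo_class" for i
    using U by (simp add: solves_ivp_def)
  then have cont: "continuous_on {0..} (\<lambda>t. U t $ i)" for i by (simp add: caputo_class_def)
  define v where "v = (\<lambda>i t. U t $ i / w $ i)"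
  have cv: "continuous_on {0..T} (v i)" for i
    unfolding v_def
    by (intro continuous_on_divide continuous_on_const continuous_on_subset[OF cont])
      (use w[of i] in auto)
  have "\<exists>s\<in>{0..T}. \<forall>r\<in>{0..T}. v i s \<le> v i r" for i
    using T by (intro continuous_attains_inf cv) auto
  then obtain s where s: "\<And>i. s i \<in> {0..T}" "\<And>i r. r \<in> {0..T} \<Longrightarrow> v i (s i) \<le> v i r"
    by metis
  obtain i where i: "\<And>k. v i (s i) \<le> v k (s k)"
    using ex_is_arg_min_if_finite[of "UNIV :: 'n set" "\<lambda>k. v k (s k)"]
    by (auto simp: is_arg_min_linorder)
  define m where "m = v i (s i)"
  have m: "m < 0"
  proof -
    have "m \<le> v i\<^sub>0 T" using i[of i\<^sub>0] s(2)[of T i\<^sub>0] T unfolding m_def by simp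
    also have "\<dots> < 0" using neg w[of i\<^sub>0] by (simp add: v_def divide_neg_pos)
    finally show ?thesis .
  qed
  have mle: "m * w $ k \<le> U r $ k" if "r \<in> {0..T}" for k r
  proof -
    have "m \<le> v k r" using i[of k] s(2)[OF that] unfolding m_def by (rule order_trans)
    then show ?thesis using w[of k] by (simp add: v_def field_simps)
  qed
  have mi: "U (s i) $ i = m * w $ i"
    using w[of i] by (simp add: m_def v_def)
  \<comment> \<open>The extremum principle is stated for positive times; nonnegative initial data
    exclude time 0.\<close>
  have "s i \<noteq> 0"
  proof
    assume "s i = 0"
    moreover have "U 0 = V" using U by (simp add: solves_ivp_def)
    ultimately have "m \<ge> 0" using V[of i] w[of i] by (simp add: m_def v_def)
    then show False using m by simp
  qed
  then have si: "s i > 0" using s(1)[of i] by simp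
  have "frac_op \<nu> (\<lambda>r. U r $ i) (s i) \<le> 0"
    using mle[of _ i] mi s(1)[of i] by (intro frac_op_nonpos_at_min cls si \<nu>) auto
  \<comment> \<open>Equality holds for \<open>k = i\<close>, where \<open>m\<close> is attained;
    elsewhere the nonpositive entry reverses \<open>m * w $ k \<le> U (s i) $ k\<close>.\<close>
  moreover have "(\<Sum>k\<in>UNIV. H $ i $ k * U (s i) $ k) \<le> (\<Sum>k\<in>UNIV. H $ i $ k * (m * w $ k))"
  proof (rule sum_mono)
    show "H $ i $ k * U (s i) $ k \<le> H $ i $ k * (m * w $ k)" for k
      using mle[OF s(1)[of i], of k] H[of i k] mi by (cases "k = i") (auto intro: mult_left_mono_neg)
  qed
  moreover have "(\<Sum>k\<in>UNIV. H $ i $ k * (m * w $ k)) = m * (H *v w) $ i"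
    by (simp add: matrix_vector_mult_def sum_distrib_left algebra_simps)
  moreover have "m * (H *v w) $ i < 0" using m Hw[of i] by (simp add: mult_neg_pos)
  ultimately show False using solves_ivp_component[OF U si, of i] by linarith
qed

text \<open>
  If \<open>H\<^sub>i\<^sub>j > 0\<close> then \<open>P(\<partial>\<^sub>t) U\<^sub>i < 0\<close> for all small \<open>t > 0\<close>; but \<open>U\<^sub>i\<close> starts at its minimum 0 and
  so attains its maximum over a short interval at a positive time.
\<close>

lemma solves_ivp_unit_vector_nonneg_imp:
  fixes H :: "real^'n^'n::finite"
  assumes \<nu>: "space \<nu> \<subseteq> {0..1}" and U: "solves_ivp \<nu> H (axis j 1) U"
    and nonneg: "\<And>t i. t \<ge> 0 \<Longrightarrow> U t $ i \<ge> 0" and ij: "i \<noteq> j"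
  shows "H $ i $ j \<le> 0"
proof (rule ccontr)
  assume pos: "\<not> H $ i $ j \<le> 0"
  have cls: "(\<lambda>t. U t $ k) \<in> caputo_class" for k
    using U by (simp add: solves_ivp_def)
  then have cont: "continuous_on {0..} (\<lambda>t. U t $ k)" for k by (simp add: caputo_class_def)
  have U0: "U 0 = axis j 1" using U by (simp add: solves_ivp_def)
  define R where "R = (\<lambda>t. \<Sum>k\<in>UNIV. H $ i $ k * U t $ k)"
  have "continuous_on {0..} R" unfolding R_def by (intro continuous_intros cont)
  moreover have "R 0 = H $ i $ j"
    by (simp add: R_def U0 axis_def if_distrib[of "(*) _"] cong: if_cong)
  ultimately have "(R \<longlongrightarrow> H $ i $ j) (at 0 within {0..})"
    by (metis continuous_on_def atLeast_iff order_refl)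
  then have "eventually (\<lambda>t. R t > 0) (at 0 within {0..})"
    using pos by (intro order_tendstoD) auto
  then obtain d where d: "d > 0" "\<And>t. t > 0 \<Longrightarrow> t < d \<Longrightarrow> R t > 0"
    by (fastforce simp: eventually_at dist_real_def)
  have "continuous_on {0..d/2} (\<lambda>t. U t $ i)" using cont by (rule continuous_on_subset) auto
  then obtain t0 where t0: "t0 \<in> {0..d/2}" "\<And>s. s \<in> {0..d/2} \<Longrightarrow> U s $ i \<le> U t0 $ i"
    using continuous_attains_sup[of "{0..d/2}" "\<lambda>t. U t $ i"] d(1) by auto
  \<comment> \<open>If the maximum over \<open>{0..d/2}\<close> is attained at 0, component
    \<open>i\<close> vanishes on the whole interval and \<open>d/2\<close> is a maximiser
    too.\<close>
  obtain t1 where t1: "0 < t1" "t1 \<le> d/2" "\<And>s. s \<in> {0..d/2} \<Longrightarrow> U s $ i \<le> U t1 $ i"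
  proof (cases "t0 = 0")
    case True
    then have "U t0 $ i = 0" using ij by (simp add: U0 axis_def)
    then have "\<And>s. s \<in> {0..d/2} \<Longrightarrow> U s $ i \<le> U (d/2) $ i"
      using t0(2) nonneg[of "d/2" i] d(1) by fastforce
    then show ?thesis using that[of "d/2"] d(1) by auto
  next
    case False
    then show ?thesis using that[of t0] t0 by auto
  qed
  have "frac_op \<nu> (\<lambda>s. U s $ i) t1 \<ge> 0"
    using t1 by (intro frac_op_nonneg_at_max cls \<nu>) auto
  moreover have "R t1 > 0" using d t1 by auto
  ultimately show False using solves_ivp_component[OF U t1(1), of i] by (simp add: R_def)
qed


section \<open>Stieltjes matrices\<close>

text \<open>Solve \<open>S *v w = 1\<close> and test with the negative part \<open>n\<close> of
  \<open>w\<close>. The supports of \<open>n\<close> and the positive part \<open>p\<close> are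
  disjoint, so \<open>n \<bullet> (S *v p) \<le> 0\<close>; with
  \<open>n \<bullet> (S *v w) \<ge> 0\<close> this gives
  \<open>n \<bullet> (S *v n) \<le> 0\<close>, hence \<open>n = 0\<close>.\<close>

lemma Stieltjes_matrix_positive_vector:
  fixes S :: "real^'n^'n::finite"
  assumes pd: "\<And>x. x \<bullet> (S *v x) \<le> 0 \<Longrightarrow> x = 0"
    and Z: "\<And>i k. i \<noteq> k \<Longrightarrow> S $ i $ k \<le> 0"
  obtains w where "\<And>i. w $ i > 0" "S *v w = 1"
proof -
  have "inj ((*v) S)"
    unfolding linear_injective_0[OF matrix_vector_mul_linear] using pd by auto
  then have "surj ((*v) S)"
    by (rule linear_injective_imp_surjective[OF matrix_vector_mul_linear]) simp
  then obtain w where w: "S *v w = 1" by (metis surjD)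
  define n where "n = (\<chi> i. max 0 (- w $ i))"
  define p where "p = (\<chi> i. max 0 (w $ i))"
  have wnp: "w = p - n" by (auto simp: vec_eq_iff p_def n_def max_def)
  have "n \<bullet> (S *v p) \<le> 0"
    unfolding inner_vec_def matrix_vector_mult_def inner_real_def vec_lambda_beta sum_distrib_left
  proof (intro sum_nonpos)
    show "n $ i * (S $ i $ k * p $ k) \<le> 0" for i k
    proof (cases "i = k")
      case True
      have "n $ i = 0 \<or> p $ i = 0" by (simp add: n_def p_def max_def)
      then show ?thesis using True by auto
    next
      case False
      have "0 \<le> n $ i * p $ k" by (simp add: n_def p_def)
      then have "(n $ i * p $ k) * S $ i $ k \<le> 0" by (rule mult_nonneg_nonpos[OF _ Z[OF False]])
      then show ?thesis by (simp add: algebra_simps)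
    qed
  qed
  moreover have "n \<bullet> (S *v w) \<ge> 0"
    unfolding w by (auto simp: inner_vec_def n_def intro: sum_nonneg)
  ultimately have "n \<bullet> (S *v n) \<le> 0"
    unfolding wnp by (simp add: matrix_vector_mult_diff_distrib inner_diff_right)
  then have "n = 0" by (rule pd)
  then have wnn: "w $ i \<ge> 0" for i
  proof -
    have "max 0 (- w $ i) = 0" using \<open>n = 0\<close> by (metis n_def vec_lambda_beta zero_index)
    then show ?thesis by (simp add: max_def split: if_splits)
  qed
  \<comment> \<open>A zero component would make its row of \<open>S *v w\<close> a sum of
    nonpositive terms, yet every row equals 1.\<close>
  have "w $ i > 0" for i
  proof (rule ccontr)
    assume "\<not> w $ i > 0"
    then have wi: "w $ i = 0" using wnn[of i] by simp
    have "(S *v w) $ i \<le> 0" unfolding matrix_vector_mult_def vec_lambda_beta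
      by (intro sum_nonpos) (metis Z mult_eq_0_iff mult_nonneg_nonpos2 order_refl wi wnn)
    then show False by (simp add: w)
  qed
  then show ?thesis using that w by blast
qed


section \<open>Triangles in the plane\<close>

text \<open>Twice the signed area: for fixed \<open>a\<close> and \<open>b\<close> its sign tells on
  which side of the line through them \<open>c\<close> lies.\<close>

definition area2 :: "real^2 \<Rightarrow> real^2 \<Rightarrow> real^2 \<Rightarrow> real" where
  "area2 a b c = (b $ 1 - a $ 1) * (c $ 2 - a $ 2) - (b $ 2 - a $ 2) * (c $ 1 - a $ 1)"

lemma area2_degenerate [simp]: "area2 a a b = 0" "area2 a b a = 0" "area2 b a a = 0"
  by (simp_all add: area2_def)

lemma continuous_on_area2 [continuous_intros]:
  assumes "continuous_on A f" "continuous_on A g" "continuous_on A h"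
  shows "continuous_on A (\<lambda>x. area2 (f x) (g x) (h x))"
  unfolding area2_def by (intro continuous_intros assms)

lemma tendsto_area2:
  assumes "(f \<longlongrightarrow> p) F" "(g \<longlongrightarrow> q) F" "(h \<longlongrightarrow> r) F"
  shows "((\<lambda>x. area2 (f x) (g x) (h x)) \<longlongrightarrow> area2 p q r) F"
  unfolding area2_def by (intro tendsto_intros assms)

lemma area2_affine:
  assumes "u + v + w = 1"
  shows "area2 a b (u *\<^sub>R p + v *\<^sub>R q + w *\<^sub>R r) = u * area2 a b p + v * area2 a b q + w * area2 a b r"
proof -
  have u: "u = 1 - v - w" using assms by simp
  show ?thesis unfolding u by (simp add: area2_def algebra_simps)
qed

lemma measure_triangle: "measure lebesgue (convex hull {a, b, c}) = \<bar>area2 a b c\<bar> / 2"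
proof -
  have "convex hull {a, b, c} \<in> sets borel"
    by (intro borel_closed compact_imp_closed finite_imp_compact_convex_hull) simp
  then show ?thesis
    using content_triangle[of a b c]
    by (simp add: area2_def measure_completion abs_minus_commute algebra_simps)
qed

lemma area2_sum: "area2 x b c + area2 a x c + area2 a b x = area2 a b c"
  by (simp add: area2_def algebra_simps)

text \<open>Cramer's rule. Orientation cancels in the quotients, so membership in the triangle
  becomes three sign conditions.\<close>

lemma barycentric:
  assumes "area2 a b c \<noteq> 0"
  shows "x = (area2 x b c / area2 a b c) *\<^sub>R a + (area2 a x c / area2 a b c) *\<^sub>R b
           + (area2 a b x / area2 a b c) *\<^sub>R c"
proof -
  have "area2 a b c * x $ i = area2 x b c * a $ i + area2 a x c * b $ i + area2 a b x * c $ i" for i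
    using exhaust_2[of i] by (auto simp: area2_def algebra_simps)
  then show ?thesis using assms by (simp add: vec_eq_iff field_simps)
qed

lemma in_triangleI:
  assumes "area2 a b c \<noteq> 0" "area2 x b c / area2 a b c \<ge> 0" "area2 a x c / area2 a b c \<ge> 0"
    "area2 a b x / area2 a b c \<ge> 0"
  shows "x \<in> convex hull {a, b, c}"
proof -
  have "area2 x b c / area2 a b c + area2 a x c / area2 a b c + area2 a b x / area2 a b c = 1"
    using area2_sum[of x b c a] assms(1) by (simp add: add_divide_distrib[symmetric])
  then show ?thesis
    unfolding convex_hull_3 using assms barycentric[OF assms(1), of x] by blast
qed

lemma area2_in_triangle:
  assumes "x \<in> convex hull {a, b, c}" 
  obtains w where "0 \<le> w" "w \<le> 1" "area2 a b x = w * area2 a b c"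
proof -
  obtain u v w where "0 \<le> u" "0 \<le> v" "0 \<le> w" and s: "u + v + w = 1"
    and x: "x = u *\<^sub>R a + v *\<^sub>R b + w *\<^sub>R c"
    using assms unfolding convex_hull_3 by blast
  then show ?thesis using that[of w] area2_affine[OF s, of a b a b c] by simp
qed

lemma interior_triangleI:
  assumes "area2 a b c \<noteq> 0" "area2 x b c / area2 a b c > 0" "area2 a x c / area2 a b c > 0"
    "area2 a b x / area2 a b c > 0"
  shows "x \<in> interior (convex hull {a, b, c})"
proof (rule interiorI)
  let ?U = "{x. area2 x b c / area2 a b c > 0} \<inter> {x. area2 a x c / area2 a b c > 0} \<inter>
    {x. area2 a b x / area2 a b c > 0}"
  show "open ?U"
    by (intro open_Int open_Collect_less continuous_intros) (use assms(1) in auto)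
  show "x \<in> ?U" using assms by simp
  show "?U \<subseteq> convex hull {a, b, c}" using assms(1) by (auto intro!: in_triangleI)
qed

text \<open>At \<open>q\<close> these coordinates are \<open>1 - t\<close> and \<open>t\<close> with
  \<open>t\<close> strictly between 0 and 1, and they depend continuously on the point. So near an
  inner edge point only the third coordinate decides membership.\<close>

lemma eventually_near_edge:
  assumes D: "area2 a b c \<noteq> 0" and q: "q \<in> open_segment a b"
  shows "eventually (\<lambda>x. area2 x b c / area2 a b c > 0 \<and> area2 a x c / area2 a b c > 0) (nhds q)"
proof -
  obtain t where t: "0 < t" "t < 1" "q = (1 - t) *\<^sub>R a + t *\<^sub>R b"
    using q by (auto simp: in_segment)
  have "area2 q b c = (1 - t) * area2 a b c" "area2 a q c = t * area2 a b c"
    unfolding t(3) by (simp_all add: area2_def algebra_simps)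
  then have "area2 q b c / area2 a b c > 0" "area2 a q c / area2 a b c > 0"
    using D t by simp_all
  moreover have "((\<lambda>x. area2 x b c / area2 a b c) \<longlongrightarrow> area2 q b c / area2 a b c) (nhds q)"
    "((\<lambda>x. area2 a x c / area2 a b c) \<longlongrightarrow> area2 a q c / area2 a b c) (nhds q)"
    by (intro tendsto_intros tendsto_area2 filterlim_ident D)+
  ultimately show ?thesis by (auto dest: order_tendstoD(1) intro: eventually_conj)
qed

text \<open>Moving from the midpoint of the common edge towards \<open>c\<close> makes the third
  coordinate positive for both triangles; the other two are positive near the edge.\<close>

lemma triangles_same_side_meet:
  assumes "area2 a b c * area2 a b d > 0"
  shows "interior (convex hull {a, b, c}) \<inter> interior (convex hull {a, b, d}) \<noteq> {}"
proof -
  have nz: "area2 a b c \<noteq> 0" "area2 a b d \<noteq> 0" using assms by auto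
  then have "a \<noteq> b" by auto
  then have q: "midpoint a b \<in> open_segment a b" by simp
  let ?q = "midpoint a b"
  let ?x = "\<lambda>t::real. ?q + t *\<^sub>R (c - ?q)"
  have "(?x \<longlongrightarrow> ?q + 0 *\<^sub>R (c - ?q)) (at_right 0)"
    by (intro tendsto_intros)
  then have lim: "filterlim ?x (nhds ?q) (at_right 0)" by simp
  have "eventually (\<lambda>t::real. t > 0) (at_right 0)" by (simp add: eventually_at_filter)
  with eventually_compose_filterlim[OF eventually_near_edge[OF nz(1) q] lim]
    eventually_compose_filterlim[OF eventually_near_edge[OF nz(2) q] lim]
  have "eventually (\<lambda>t. ?x t \<in> interior (convex hull {a, b, c}) \<inter> interior (convex hull {a, b, d}))
      (at_right 0)"
  proof eventually_elim
    case (elim t)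
    have "area2 a b (?x t) = t * area2 a b c"
      by (simp add: area2_def midpoint_def field_simps)
    then show ?case using elim nz assms
      by (auto intro!: interior_triangleI simp: zero_less_mult_iff zero_less_divide_iff mult_less_0_iff)
  qed
  then show ?thesis
    by (metis (no_types, lifting) empty_iff eventually_False eventually_mono trivial_limit_at_right_real)
qed

text \<open>A point near \<open>q\<close> lies on the side of \<open>c\<close>, on that of
  \<open>d\<close>, or on the line, so one of the two triangles contains it.\<close>

lemma open_segment_interior_two_triangles:
  assumes opp: "area2 a b c * area2 a b d < 0" and q: "q \<in> open_segment a b"
  shows "q \<in> interior (convex hull {a, b, c} \<union> convex hull {a, b, d})"
proof -
  have nz: "area2 a b c \<noteq> 0" "area2 a b d \<noteq> 0" using opp by auto
  have "eventually (\<lambda>x. x \<in> convex hull {a, b, c} \<union> convex hull {a, b, d}) (nhds q)"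
    using eventually_near_edge[OF nz(1) q] eventually_near_edge[OF nz(2) q]
  proof eventually_elim
    case (elim x)
    have "area2 a b x / area2 a b c \<ge> 0 \<or> area2 a b x / area2 a b d \<ge> 0"
      using opp by (auto simp: zero_le_divide_iff mult_less_0_iff)
    then show ?case using elim nz by (auto intro!: in_triangleI simp: less_imp_le)
  qed
  then show ?thesis by (auto simp: eventually_nhds interior_def)
qed

section \<open>Nondegenerate triangles and their vertices\<close>

lemma not_affine_dependent_area2:
  assumes "\<not> affine_dependent {a, b, c}" "card {a, b, c} = 3"
  shows "area2 a b c \<noteq> 0"
proof
  assume D: "area2 a b c = 0"
  have dist: "a \<noteq> b" "a \<noteq> c" "b \<noteq> c"
    using assms(2) by (auto simp: card_insert_if split: if_splits)
  \<comment> \<open>The coefficient of the orthogonal projection of \<open>c - a\<close> onto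
    \<open>b - a\<close>; zero area makes the projection equal to \<open>c - a\<close>.\<close>
  define t where "t = (c - a) \<bullet> (b - a) / ((b - a) \<bullet> (b - a))"
  have n: "(b - a) \<bullet> (b - a) \<noteq> 0" using dist by simp
  have "((b - a) \<bullet> (b - a)) *\<^sub>R (c - a) = ((c - a) \<bullet> (b - a)) *\<^sub>R (b - a)"
    using D unfolding vec_eq_iff forall_2
    by (simp add: inner_vec_def sum_2 area2_def) algebra
  then have "(1 / ((b - a) \<bullet> (b - a))) *\<^sub>R ((b - a) \<bullet> (b - a)) *\<^sub>R (c - a) = t *\<^sub>R (b - a)"
    by (simp only:) (simp add: t_def)
  then have "c - a = t *\<^sub>R (b - a)"
    using n by simp
  then have "c = t *\<^sub>R b + (1 - t) *\<^sub>R a" by (simp add: algebra_simps)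
  then have "collinear {b, c, a}" unfolding collinear_3_expand by blast
  then have "collinear {a, b, c}" by (simp add: insert_commute)
  then show False using assms(1) dist by (simp add: collinear_3_eq_affine_dependent)
qed

lemma triangle_vertices:
  assumes "2 simplex K"
  shows "card (vertices K) = 3" "K = convex hull (vertices K)" "\<not> affine_dependent (vertices K)"
proof -
  obtain C where C: "\<not> affine_dependent C" "card C = 3" "K = convex hull C"
    using assms by (auto simp: simplex_def)
  have "vertices K = C"
    unfolding vertices_def C(3) using extreme_point_of_convex_hull_affine_independent[OF C(1)] by auto
  with C show "card (vertices K) = 3" "K = convex hull (vertices K)" "\<not> affine_dependent (vertices K)"
    by auto
qed

text \<open>The extreme points of the hull are among the generators, and a 2-simplex has three of
  them, so no generator is repeated or lost.\<close>

lemma vertices_triangle: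
  assumes "2 simplex (convex hull {a, b, c})"
  shows "vertices (convex hull {a, b, c}) = {a, b, c}" "card {a, b, c} = 3"
    "a \<noteq> b" "a \<noteq> c" "b \<noteq> c" "area2 a b c \<noteq> 0"
proof -
  have sub: "vertices (convex hull {a, b, c}) \<subseteq> {a, b, c}"
    by (auto simp: vertices_def dest: extreme_point_of_convex_hull)
  show v: "vertices (convex hull {a, b, c}) = {a, b, c}"
    using triangle_vertices(1)[OF assms]
    by (intro card_seteq sub) (auto simp: card_insert_if)
  show card: "card {a, b, c} = 3" using triangle_vertices(1)[OF assms] v by simp
  then show "a \<noteq> b" "a \<noteq> c" "b \<noteq> c" by (auto simp: card_insert_if split: if_splits)
  show "area2 a b c \<noteq> 0"
    using triangle_vertices(3)[OF assms] v card by (intro not_affine_dependent_area2) auto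
qed

lemma triangle_with_edge:
  assumes "2 simplex K" "a \<in> vertices K" "b \<in> vertices K" "a \<noteq> b"
  obtains c where "K = convex hull {a, b, c}"
proof -
  have "card (vertices K - {a, b}) = 1"
    using triangle_vertices(1)[OF assms(1)] assms
    by (subst card_Diff_subset) auto
  then obtain c where "vertices K - {a, b} = {c}" by (auto simp: card_1_singleton_iff)
  then have "vertices K = {a, b, c}" using assms by blast
  then show ?thesis using that triangle_vertices(2)[OF assms(1)] by simp
qed

lemma triangle_with_vertex:
  assumes "2 simplex K" "a \<in> vertices K"
  obtains b c where "K = convex hull {a, b, c}"
proof -
  have "vertices K \<noteq> {a}" using triangle_vertices(1)[OF assms(1)] by auto
  then obtain b where "b \<in> vertices K" "a \<noteq> b" using assms(2) by auto
  then show ?thesis using triangle_with_edge[OF assms(1,2)] that by metis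
qed

lemma triangle_exists_hull:
  fixes K :: "(real^2) set"
  assumes "2 simplex K"
  obtains a b c where "K = convex hull {a, b, c}"
proof -
  obtain a where "a \<in> vertices K" using triangle_vertices(1)[OF assms] by fastforce
  then show ?thesis using triangle_with_vertex[OF assms] that by metis
qed

section \<open>Gradients, angles and cotangents\<close>

text \<open>With \<open>c\<close> as origin, \<open>g\<close> and \<open>h\<close> are the basis
  dual to \<open>a - c\<close> and \<open>b - c\<close>; their product is the off-diagonal entry of
  the inverse Gram matrix.\<close>

lemma inner_triangle_gradients:
  fixes g h a b c :: "real^2"
  assumes "g \<bullet> a + k = 1" "g \<bullet> b + k = 0" "g \<bullet> c + k = 0"
    "h \<bullet> a + l = 0" "h \<bullet> b + l = 1" "h \<bullet> c + l = 0"
  shows "g \<bullet> h * (area2 a b c)\<^sup>2 = - ((a - c) \<bullet> (b - c))"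
proof -
  define p where "p = a - c"
  define q where "q = b - c"
  have D: "area2 a b c = p $ 1 * q $ 2 - p $ 2 * q $ 1"
    by (simp add: area2_def p_def q_def algebra_simps)
  have "g \<bullet> p = 1" "g \<bullet> q = 0" "h \<bullet> p = 0" "h \<bullet> q = 1"
    using assms by (auto simp: p_def q_def inner_diff_right)
  then show ?thesis unfolding D p_def[symmetric] q_def[symmetric]
    by (simp add: inner_vec_def sum_2) algebra
qed

text \<open>Lagrange's identity, with \<open>area2 a b c\<close> as the cross product of
  \<open>a - c\<close> and \<open>b - c\<close>.\<close>

lemma norm_product_eq:
  fixes a b c :: "real^2"
  shows "norm (a - c) * norm (b - c) = sqrt (((a - c) \<bullet> (b - c))\<^sup>2 + (area2 a b c)\<^sup>2)"
proof (rule real_sqrt_unique[symmetric])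
  show "(norm (a - c) * norm (b - c))\<^sup>2 = ((a - c) \<bullet> (b - c))\<^sup>2 + (area2 a b c)\<^sup>2"
    unfolding power_mult_distrib power2_norm_eq_inner
    by (simp add: inner_vec_def sum_2 area2_def) algebra
qed simp

text \<open>The expression is the sine of \<open>arctan x\<close>, a composition of increasing
  functions. It turns the cotangent of an angle between 0 and \<open>pi\<close> into its
  cosine.\<close>

lemma div_sqrt_le_iff:
  fixes x y :: real
  shows "x / sqrt (1 + x\<^sup>2) \<le> y / sqrt (1 + y\<^sup>2) \<longleftrightarrow> x \<le> y"
  using sin_arctan[of x] sin_arctan[of y] arctan_bounded[of x] arctan_bounded[of y]
    sin_mono_le_eq[of "arctan x" "arctan y"] by (simp add: arctan_le_iff)

text \<open>\<open>k e\<close> is the cotangent and \<open>r e\<close> the cosine of the angle at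
  \<open>e\<close>. As \<open>pi - arccos y = arccos (- y)\<close>, the bound on the sum compares
  two arccosines, hence two cosines, hence two cotangents.\<close>

lemma angle_sum_le_pi_iff:
  assumes D: "area2 a b c \<noteq> 0" "area2 a b d \<noteq> 0"
  shows "angle a c b + angle a d b \<le> pi \<longleftrightarrow>
    (a - c) \<bullet> (b - c) / \<bar>area2 a b c\<bar> + (a - d) \<bullet> (b - d) / \<bar>area2 a b d\<bar> \<ge> 0"
proof -
  define k where "k = (\<lambda>c. (a - c) \<bullet> (b - c) / \<bar>area2 a b c\<bar>)"
  define r where "r = (\<lambda>c. k c / sqrt (1 + (k c)\<^sup>2))"
  have ang: "angle a e b = arccos (r e)" if "area2 a b e \<noteq> 0" for e
  proof -
    have "sqrt (1 + (k e)\<^sup>2) = sqrt ((((a - e) \<bullet> (b - e))\<^sup>2 + (area2 a b e)\<^sup>2) / (area2 a b e)\<^sup>2)"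
      using that by (simp add: k_def field_simps power_divide)
    also have "\<dots> = norm (a - e) * norm (b - e) / \<bar>area2 a b e\<bar>"
      by (simp add: norm_product_eq real_sqrt_divide)
    finally show ?thesis using that by (simp add: angle_def r_def k_def)
  qed
  have "\<bar>k e\<bar> \<le> sqrt (1 + (k e)\<^sup>2)" for e
    by (rule real_le_rsqrt) simp
  then have r1: "\<bar>r e\<bar> \<le> 1" for e
    by (simp add: r_def abs_divide divide_le_eq_1 add_pos_nonneg)
  have "angle a c b + angle a d b \<le> pi \<longleftrightarrow> arccos (r c) \<le> arccos (- r d)"
    using r1[of d] by (simp add: ang D arccos_minus abs_le_iff algebra_simps)
  also have "\<dots> \<longleftrightarrow> - r d \<le> r c"
    using r1[of c] r1[of d] by (simp add: arccos_le_mono)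
  also have "\<dots> \<longleftrightarrow> - k d \<le> k c"
    using div_sqrt_le_iff[of "- k d" "k c"] by (simp add: r_def)
  also have "\<dots> \<longleftrightarrow> k c + k d \<ge> 0" by linarith
  finally show ?thesis by (simp add: k_def)
qed

lemma affine_constant_triangle:
  fixes g a b c :: "real^2"
  assumes "g \<bullet> a = g \<bullet> c" "g \<bullet> b = g \<bullet> c" "area2 a b c \<noteq> 0"
  shows "g = 0"
proof -
  have "area2 a b c * g $ 1 = 0" "area2 a b c * g $ 2 = 0"
    using assms(1,2) by (simp_all add: inner_vec_def sum_2 area2_def) algebra+
  then show ?thesis using assms(3) by (simp add: vec_eq_iff forall_2)
qed

lemma points_on_segment_near_endpoint:
  fixes a b :: "'a::real_normed_vector"
  assumes "open S" "a \<in> S" "a \<noteq> b"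
  obtains q where "q \<in> open_segment a b" "q \<in> S"
proof -
  have "((\<lambda>t::real. (1 - t) *\<^sub>R a + t *\<^sub>R b) \<longlongrightarrow> (1 - 0) *\<^sub>R a + 0 *\<^sub>R b) (at_right 0)"
    by (intro tendsto_intros)
  then have "eventually (\<lambda>t::real. (1 - t) *\<^sub>R a + t *\<^sub>R b \<in> S) (at_right 0)"
    using assms by (auto dest: topological_tendstoD)
  moreover have "eventually (\<lambda>t::real. t \<in> {0<..<1}) (at_right 0)"
    by (rule eventually_at_right_real) simp
  ultimately have "eventually (\<lambda>t::real. (1 - t) *\<^sub>R a + t *\<^sub>R b \<in> S \<and> t \<in> {0<..<1}) (at_right 0)"
    by (rule eventually_conj)
  then obtain t :: real where "(1 - t) *\<^sub>R a + t *\<^sub>R b \<in> S" "t \<in> {0<..<1}"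
    using eventually_happens'[OF trivial_limit_at_right_real] by blast
  then show ?thesis using that[of "(1 - t) *\<^sub>R a + t *\<^sub>R b"] assms(3) by (auto simp: in_segment)
qed


section \<open>Edges of the triangulation\<close>

locale triangulated_domain =
  fixes \<Omega> :: "(real^2) set" and \<T> :: "(real^2) set set"
  assumes domain: "polygonal_domain \<Omega>" and mesh: "triangulates \<T> \<Omega>"
begin

lemma open_domain: "open \<Omega>" and interior_closure_domain: "interior (closure \<Omega>) = \<Omega>"
  using domain by (auto simp: polygonal_domain_def)

lemma finite_mesh: "finite \<T>"
  and simplex_mesh: "K \<in> \<T> \<Longrightarrow> 2 simplex K"
  and face_mesh: "K \<in> \<T> \<Longrightarrow> K' \<in> \<T> \<Longrightarrow> K \<inter> K' face_of K"
  and Union_mesh: "\<Union>\<T> = closure \<Omega>"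
  using mesh by (auto simp: triangulates_def triangulation_def)

lemma compact_mesh: "K \<in> \<T> \<Longrightarrow> compact K"
  using simplex_mesh by (auto simp: simplex intro: finite_imp_compact_convex_hull)

lemma convex_mesh: "K \<in> \<T> \<Longrightarrow> convex K"
  using simplex_mesh by (auto simp: simplex_def)

text \<open>The intersection is a face of each triangle, and a proper face misses the interior; so
  each triangle contains the other.\<close>

lemma mesh_interiors_meet_imp_eq:
  assumes "K \<in> \<T>" "K' \<in> \<T>" "interior K \<inter> interior K' \<noteq> {}"
  shows "K = K'"
proof -
  have "L \<subseteq> L'" if "L \<in> \<T>" "L' \<in> \<T>" "interior L \<inter> interior L' \<noteq> {}" for L L'
  proof (rule ccontr)
    assume "\<not> L \<subseteq> L'"
    then have "L \<inter> L' \<inter> interior L = {}"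
      using face_of_disjoint_interior[OF face_mesh[OF that(1,2)]] by blast
    then show False using that(3) interior_subset[of L] interior_subset[of L'] by blast
  qed
  then show ?thesis using assms by (metis Int_commute subset_antisym)
qed

lemma mesh_same_side_eq:
  assumes "convex hull {a, b, c} \<in> \<T>" "convex hull {a, b, d} \<in> \<T>" "area2 a b c * area2 a b d > 0"
  shows "convex hull {a, b, c} = convex hull {a, b, d}"
  using mesh_interiors_meet_imp_eq[OF assms(1,2)] triangles_same_side_meet[OF assms(3)] by blast

text \<open>Points just beyond \<open>q\<close>, seen from \<open>c\<close>, lie in \<Omega> and are
  covered by finitely many triangles. One of these contains such points arbitrarily close to
  \<open>q\<close>; it has \<open>a\<close> and \<open>b\<close> as vertices and lies across the
  edge.\<close>

lemma mesh_opposite_triangle: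
  assumes K: "convex hull {a, b, c} \<in> \<T>" and q: "q \<in> open_segment a b" "q \<in> \<Omega>"
  obtains d where "convex hull {a, b, d} \<in> \<T>" "area2 a b c * area2 a b d < 0"
proof -
  let ?K = "convex hull {a, b, c}"
  note vK = vertices_triangle[OF simplex_mesh[OF K]]
  let ?x = "\<lambda>t::real. q + t *\<^sub>R (q - c)"
  have "(?x \<longlongrightarrow> q + 0 *\<^sub>R (q - c)) (at_right 0)" by (intro tendsto_intros)
  then have lim: "(?x \<longlongrightarrow> q) (at_right 0)" by simp
  then have "eventually (\<lambda>t. ?x t \<in> \<Omega>) (at_right 0)"
    using open_domain q(2) by (rule topological_tendstoD)
  then have cover: "eventually (\<lambda>t. \<exists>K'\<in>\<T>. ?x t \<in> K') (at_right 0)"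
    using Union_mesh closure_subset[of \<Omega>] by (auto elim!: eventually_mono)
  have "\<not> (\<forall>K'\<in>\<T>. eventually (\<lambda>t. ?x t \<notin> K') (at_right 0))"
  proof
    assume "\<forall>K'\<in>\<T>. eventually (\<lambda>t. ?x t \<notin> K') (at_right 0)"
    from cover eventually_ball_finite[OF finite_mesh this]
    have "eventually (\<lambda>t::real. False) (at_right 0)" by eventually_elim blast
    then show False by simp
  qed
  then obtain K' where K': "K' \<in> \<T>" and fr: "frequently (\<lambda>t. ?x t \<in> K') (at_right 0)"
    by (auto simp: frequently_def)
  have "q \<in> K'"
  proof (rule ccontr)
    assume "q \<notin> K'"
    then have "eventually (\<lambda>t. ?x t \<in> - K') (at_right 0)"
      using compact_mesh[OF K'] by (intro topological_tendstoD[OF lim]) (auto intro: compact_imp_closed)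
    then show False using fr by (simp add: frequently_def)
  qed
  have ab: "a \<in> ?K" "b \<in> ?K" by (auto intro: hull_inc)
  have "q \<in> ?K"
    using q(1) closed_segment_subset[OF ab convex_convex_hull] segment_open_subset_closed by blast
  \<comment> \<open>A face containing an inner point of a segment in \<open>?K\<close> contains both
    endpoints.\<close>
  then have "a \<in> ?K \<inter> K' \<and> b \<in> ?K \<inter> K'"
    using face_mesh[OF K K'] ab q(1) \<open>q \<in> K'\<close> unfolding face_of_def by blast
  moreover have "K' \<inter> ?K face_of K'" using face_mesh[OF K' K] .
  moreover have "a \<in> vertices ?K" "b \<in> vertices ?K" using vK(1) by simp_all
  \<comment> \<open>Extreme points of \<open>?K\<close> are extreme in the common face, hence in
    \<open>K'\<close>.\<close>
  ultimately have "a \<in> vertices K'" "b \<in> vertices K'"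
    using extreme_point_of_face[OF face_mesh[OF K K']] extreme_point_of_face[of "K' \<inter> ?K" K']
    by (auto simp: vertices_def Int_commute)
  then obtain d where d: "K' = convex hull {a, b, d}"
    using triangle_with_edge[OF simplex_mesh[OF K']] vK(3) by metis
  have "eventually (\<lambda>t. ?x t \<in> K' \<longrightarrow> ?x t \<in> K' \<and> t > 0) (at_right 0)"
    by (simp add: eventually_at_filter)
  with fr have "frequently (\<lambda>t. ?x t \<in> K' \<and> t > 0) (at_right 0)"
    by (rule frequently_rev_mp)
  then obtain t where t: "?x t \<in> K'" "t > 0" by (auto dest: frequently_ex)
  obtain w where w: "0 \<le> w" "area2 a b (?x t) = w * area2 a b d"
    using area2_in_triangle[OF t(1)[unfolded d]] .
  have "area2 a b (?x t) = - t * area2 a b c"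
  proof -
    obtain s where s: "q = (1 - s) *\<^sub>R a + s *\<^sub>R b" using q(1) by (auto simp: in_segment)
    show ?thesis unfolding s by (simp add: area2_def algebra_simps)
  qed
  then have "w * (area2 a b c * area2 a b d) = - t * (area2 a b c)\<^sup>2"
    using w(2) by (simp only: power2_eq_square) algebra
  also have "\<dots> < 0" using t vK(6) by simp
  finally have "area2 a b c * area2 a b d < 0" using w(1) by (simp add: mult_less_0_iff)
  then show ?thesis using that K' d by blast
qed

text \<open>
  An edge issuing from a point of the open set \<open>\<Omega>\<close> cannot be a boundary edge, so exactly two
  triangles share it.
\<close>

lemma mesh_edge_patch:
  assumes K: "convex hull {a, b, c} \<in> \<T>" and ab: "a \<in> \<Omega>" "b \<in> \<Omega>"
  obtains d where "convex hull {a, b, d} \<in> \<T>" "c \<noteq> d"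
    "convex hull {a, b, c} \<noteq> convex hull {a, b, d}" "closed_segment a b \<subseteq> \<Omega>"
    "{K\<in>\<T>. a \<in> vertices K \<and> b \<in> vertices K} = {convex hull {a, b, c}, convex hull {a, b, d}}"
proof -
  note vK = vertices_triangle[OF simplex_mesh[OF K]]
  obtain q where q: "q \<in> open_segment a b" "q \<in> \<Omega>"
    using points_on_segment_near_endpoint[OF open_domain ab(1) vK(3)] .
  obtain d where d: "convex hull {a, b, d} \<in> \<T>" and opp: "area2 a b c * area2 a b d < 0"
    using mesh_opposite_triangle[OF K q] .
  note vK' = vertices_triangle[OF simplex_mesh[OF d]]
  have cd: "c \<noteq> d" using opp by (metis not_square_less_zero)
  then have ne: "convex hull {a, b, c} \<noteq> convex hull {a, b, d}"
    using vK(1,4,5) vK'(1) by (metis insert_iff singletonD)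
  \<comment> \<open>The condition \<open>interior (closure \<Omega>) = \<Omega>\<close> rules out a
    crack along the edge.\<close>
  have "open_segment a b \<subseteq> \<Omega>"
  proof
    fix p assume "p \<in> open_segment a b"
    then have "p \<in> interior (convex hull {a, b, c} \<union> convex hull {a, b, d})"
      by (rule open_segment_interior_two_triangles[OF opp])
    also have "\<dots> \<subseteq> interior (closure \<Omega>)"
      using K d Union_mesh by (intro interior_mono) blast
    finally show "p \<in> \<Omega>" by (simp add: interior_closure_domain)
  qed
  then have seg: "closed_segment a b \<subseteq> \<Omega>"
    using ab by (auto simp: closed_segment_eq_open)
  have "{K\<in>\<T>. a \<in> vertices K \<and> b \<in> vertices K} = {convex hull {a, b, c}, convex hull {a, b, d}}"
  proof (intro equalityI subsetI)
    fix L assume "L \<in> {K\<in>\<T>. a \<in> vertices K \<and> b \<in> vertices K}"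
    then have L: "L \<in> \<T>" "a \<in> vertices L" "b \<in> vertices L" by auto
    then obtain e where e: "L = convex hull {a, b, e}"
      using triangle_with_edge[OF simplex_mesh[OF L(1)]] vK(3) by metis
    then have "area2 a b e \<noteq> 0" using vertices_triangle(6) simplex_mesh L(1) by metis
    \<comment> \<open>Since \<open>c\<close> and \<open>d\<close> lie on opposite sides,
      \<open>e\<close> shares a side with one of them, and mesh triangles on the same side of an
      edge coincide.\<close>
    then have "area2 a b c * area2 a b e > 0 \<or> area2 a b d * area2 a b e > 0"
      using opp by (auto simp: zero_less_mult_iff mult_less_0_iff)
    then show "L \<in> {convex hull {a, b, c}, convex hull {a, b, d}}"
      using mesh_same_side_eq K d L(1) unfolding e by blast
  qed (use K d vK(1) vK'(1) in auto)
  then show ?thesis using that d cd ne seg by blast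
qed

lemma interior_edge_triangle:
  assumes "convex hull {a, b, c} \<in> \<T>" "closed_segment a b \<subseteq> \<Omega>"
  shows "closed_segment a b \<in> interior_edges \<T> \<Omega>"
proof -
  note vK = vertices_triangle[OF simplex_mesh[OF assms(1)]]
  have "\<not> affine_dependent {a, b, c}"
    using triangle_vertices(3)[OF simplex_mesh[OF assms(1)]] vK(1) by simp
  then have "closed_segment a b edge_of convex hull {a, b, c}"
    using vK(3) unfolding edge_of_def segment_convex_hull
    by (auto simp: face_of_convex_hull_affine_independent aff_dim_convex_hull
        intro!: exI[of _ "{a, b}"])
  then show ?thesis using assms by (auto simp: interior_edges_def)
qed

end


section \<open>Finite element matrices\<close>

locale lumped_mass_method = triangulated_domain +
  fixes P :: "'n::finite \<Rightarrow> real^2" and \<phi> :: "'n \<Rightarrow> real^2 \<Rightarrow> real"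
  assumes nodes: "bij_betw P UNIV (interior_nodes \<T> \<Omega>)" and basis: "nodal_basis \<T> \<Omega> P \<phi>"
begin

lemma P_inj: "P i = P j \<longleftrightarrow> i = j"
  using nodes by (auto simp: bij_betw_def inj_on_def)

lemma P_range: "range P = (\<Union>K\<in>\<T>. vertices K) \<inter> \<Omega>"
  using nodes by (simp add: bij_betw_def interior_nodes_def)

lemma P_domain: "P i \<in> \<Omega>"
  using P_range by blast

lemma continuous_on_basis: "continuous_on (closure \<Omega>) (\<phi> i)"
  and basis_frontier: "x \<in> frontier \<Omega> \<Longrightarrow> \<phi> i x = 0"
  and basis_node: "\<phi> i (P j) = (if i = j then 1 else 0)"
  using basis by (simp_all add: nodal_basis_def fe_space_def)

text \<open>A vertex outside \<Omega> lies on the frontier, where basis functions vanish; every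
  other vertex is a node.\<close>

lemma basis_vertex:
  assumes "K \<in> \<T>" "v \<in> vertices K"
  shows "\<phi> i v = (if v = P i then 1 else 0)"
proof (cases "v \<in> \<Omega>")
  case True
  then obtain j where "v = P j" using P_range assms by blast
  then show ?thesis by (auto simp: basis_node P_inj)
next
  case False
  have "v \<in> closure \<Omega>"
    using assms Union_mesh by (auto simp: vertices_def extreme_point_of_def)
  then have "v \<in> frontier \<Omega>"
    using False open_domain by (simp add: frontier_def interior_open)
  then have "\<phi> i v = 0" by (rule basis_frontier)
  then show ?thesis using False P_domain[of i] by auto
qed

text \<open>On a mesh triangle the affine form determines \<open>g\<close>. Tying it to the triangle
  avoids edge points, where the classical gradient may not exist.\<close>

definition grad :: "(real^2) set \<Rightarrow> 'n \<Rightarrow> real^2" where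
  "grad K i = (SOME g. \<exists>k. \<forall>x\<in>K. \<phi> i x = g \<bullet> x + k)"

lemma basis_affine:
  assumes "K \<in> \<T>"
  obtains k where "\<And>x. x \<in> K \<Longrightarrow> \<phi> i x = grad K i \<bullet> x + k"
proof -
  have "\<exists>g k. \<forall>x\<in>K. \<phi> i x = g \<bullet> x + k"
    using basis assms by (auto simp: nodal_basis_def fe_space_def)
  then have "\<exists>k. \<forall>x\<in>K. \<phi> i x = grad K i \<bullet> x + k"
    unfolding grad_def by (rule someI_ex)
  then show ?thesis using that by blast
qed

lemma gradient_basis:
  assumes "K \<in> \<T>" "x \<in> interior K"
  shows "gradient (\<phi> i) x = grad K i"
proof -
  obtain k where k: "\<And>x. x \<in> K \<Longrightarrow> \<phi> i x = grad K i \<bullet> x + k"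
    using basis_affine[OF assms(1)] by blast
  have D0: "((\<lambda>x. grad K i \<bullet> x + k) has_derivative (\<lambda>h. h \<bullet> grad K i)) (at x)"
    by (auto intro!: derivative_eq_intros simp: inner_commute)
  have D: "GDERIV (\<phi> i) x :> grad K i"
    unfolding gderiv_def
  proof (rule has_derivative_transform_within_open[OF D0 open_interior assms(2)])
    show "grad K i \<bullet> y + k = \<phi> i y" if "y \<in> interior K" for y
      using k[of y] that interior_subset[of K] by auto
  qed
  show ?thesis unfolding gradient_def
  proof (rule the_equality)
    fix g assume "GDERIV (\<phi> i) x :> g"
    then have "(\<lambda>h. h \<bullet> g) = (\<lambda>h. h \<bullet> grad K i)"
      using D unfolding gderiv_def by (rule has_derivative_unique)
    then have "h \<bullet> g = h \<bullet> grad K i" for h by (rule fun_cong)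
    then show "g = grad K i" using vector_eq_ldot by blast
  qed (rule D)
qed

lemma grad_eq_0:
  assumes K: "K \<in> \<T>" and i: "P i \<notin> vertices K"
  shows "grad K i = 0"
proof -
  obtain a b c where abc: "K = convex hull {a, b, c}" using triangle_exists_hull[OF simplex_mesh[OF K]] .
  note vK = vertices_triangle[OF simplex_mesh[OF K, unfolded abc], folded abc]
  obtain k where k: "\<And>x. x \<in> K \<Longrightarrow> \<phi> i x = grad K i \<bullet> x + k"
    using basis_affine[OF K] by blast
  have "grad K i \<bullet> x + k = 0" if "x \<in> {a, b, c}" for x
  proof -
    have "x \<in> K" unfolding abc using that by (auto intro: hull_inc)
    moreover have "x \<in> vertices K" using that vK(1) by simp
    ultimately show ?thesis using k basis_vertex[OF K, of x i] i by auto
  qed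
  from this[of a] this[of b] this[of c] show ?thesis
    by (intro affine_constant_triangle[OF _ _ vK(6)]) auto
qed

text \<open>Off the triangle frontiers, a null set, each point of \<Omega> lies in the interior of
  exactly one triangle; so the integrand agrees almost everywhere with the step function
  \<open>g\<close>.\<close>

lemma stiffness_entry:
  "stiffness_matrix \<Omega> \<phi> $ i $ j = (\<Sum>K\<in>\<T>. measure lebesgue K * (grad K j \<bullet> grad K i))"
proof -
  define f where "f = (\<lambda>x. indicat_real \<Omega> x *\<^sub>R (gradient (\<phi> j) x \<bullet> gradient (\<phi> i) x))"
  define g where "g = (\<lambda>x. \<Sum>K\<in>\<T>. (grad K j \<bullet> grad K i) * indicat_real (interior K) x)"
  have meas: "interior K \<in> sets lebesgue" "emeasure lebesgue (interior K) < \<infinity>"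
    "measure lebesgue (interior K) = measure lebesgue K" "negligible (frontier K)" if "K \<in> \<T>" for K
  proof -
    show n: "negligible (frontier K)"
      by (rule negligible_convex_frontier[OF convex_mesh[OF that]])
    have b: "bounded K" using compact_mesh[OF that] by (rule compact_imp_bounded)
    show "measure lebesgue (interior K) = measure lebesgue K" using b n by (rule measure_interior)
    show "emeasure lebesgue (interior K) < \<infinity>"
      using emeasure_bounded_finite[OF bounded_interior[OF b]] by simp
  qed simp
  have "negligible (\<Union>K\<in>\<T>. frontier K)"
    using meas finite_mesh by (intro negligible_Union) auto
  then have "AE x in lebesgue. x \<notin> (\<Union>K\<in>\<T>. frontier K)"
    unfolding negligible_iff_null_sets by (rule AE_not_in)
  then have ae: "AE x in lebesgue. g x = f x"
  proof eventually_elim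
    case (elim x)
    show ?case
    proof (cases "\<exists>K\<in>\<T>. x \<in> interior K")
      case True
      then obtain K where K: "K \<in> \<T>" "x \<in> interior K" by blast
      have "g x = (\<Sum>K'\<in>\<T>. if K' = K then grad K j \<bullet> grad K i else 0)"
        unfolding g_def using mesh_interiors_meet_imp_eq[OF K(1)] K(2)
        by (intro sum.cong) (auto simp: indicator_def)
      moreover have "x \<in> \<Omega>"
        using K Union_mesh interior_mono[of K "closure \<Omega>"] interior_closure_domain by blast
      ultimately show ?thesis using K finite_mesh by (simp add: f_def gradient_basis)
    next
      case False
      then have "x \<notin> \<Union>\<T>"
        using elim closure_subset by (fastforce simp: frontier_def)
      then have "x \<notin> \<Omega>" using Union_mesh closure_subset by auto
      then show ?thesis using False by (auto simp: f_def g_def intro!: sum.neutral)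
    qed
  qed
  have gm: "g \<in> borel_measurable lebesgue"
    unfolding g_def using meas by (intro borel_measurable_sum borel_measurable_times borel_measurable_indicator) auto
  have "stiffness_matrix \<Omega> \<phi> $ i $ j = integral\<^sup>L lebesgue f"
    by (simp add: stiffness_matrix_def set_lebesgue_integral_def f_def)
  \<comment> \<open>Lebesgue measure is complete, so \<open>f\<close> inherits measurability from
    \<open>g\<close>.\<close>
  also have "\<dots> = integral\<^sup>L lebesgue g"
    using ae by (intro integral_cong_AE borel_measurable_AE[OF gm ae] gm) auto
  also have "\<dots> = (\<Sum>K\<in>\<T>. measure lebesgue K * (grad K j \<bullet> grad K i))"
    unfolding g_def using meas
    by (subst Bochner_Integration.integral_sum) (auto simp: mult.commute intro!: sum.cong)
  finally show ?thesis .
qed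

definition lumped_mass :: "'n \<Rightarrow> real" where
  "lumped_mass i = (\<Sum>K\<in>\<T>. if P i \<in> vertices K then measure lebesgue K / 3 else 0)"

lemma lumped_mass_matrix_entry:
  "lumped_mass_matrix \<T> \<phi> $ i $ j = (if i = j then lumped_mass i else 0)"
proof -
  have "(\<Sum>p\<in>vertices K. \<phi> j p * \<phi> i p) = (if i = j \<and> P i \<in> vertices K then 1 else 0)" if K: "K \<in> \<T>" for K
  proof -
    have fin: "finite (vertices K)"
      using triangle_vertices(1)[OF simplex_mesh[OF K]] card.infinite by fastforce
    have "(\<Sum>p\<in>vertices K. \<phi> j p * \<phi> i p) = (\<Sum>p\<in>vertices K. if p = P i then (if i = j then 1 else 0) else 0)"
      by (intro sum.cong) (auto simp: basis_vertex[OF K] P_inj)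
    then show ?thesis using fin by simp
  qed
  then show ?thesis
    by (auto simp: lumped_mass_matrix_def lumped_product_def lumped_mass_def intro!: sum.cong)
qed

lemma measure_mesh_pos: "K \<in> \<T> \<Longrightarrow> measure lebesgue K > 0"
  using triangle_exists_hull[OF simplex_mesh] vertices_triangle(6)[OF simplex_mesh]
  by (metis measure_triangle half_gt_zero zero_less_abs_iff)

lemma lumped_mass_pos: "lumped_mass i > 0"
proof -
  obtain K where K: "K \<in> \<T>" "P i \<in> vertices K" using P_range by blast
  show ?thesis unfolding lumped_mass_def
    by (rule sum_pos2[OF finite_mesh K(1)]) (use K measure_mesh_pos in \<open>auto simp: less_imp_le\<close>)
qed

text \<open>
  \<^const>\<open>matrix_inv\<close> is an unspecified matrix unless its argument is invertible, hence the
  determinant.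
\<close>

lemma LM_matrix_mult: "lumped_mass_matrix \<T> \<phi> ** LM_matrix \<T> \<Omega> \<phi> = stiffness_matrix \<Omega> \<phi>"
proof -
  let ?M = "lumped_mass_matrix \<T> \<phi>"
  have "det ?M = (\<Prod>i\<in>UNIV. ?M $ i $ i)"
    by (rule det_diagonal) (simp add: lumped_mass_matrix_entry)
  also have "\<dots> \<noteq> 0"
    using lumped_mass_pos less_imp_neq by (fastforce simp: lumped_mass_matrix_entry)
  finally have "invertible ?M" by (simp add: invertible_det_nz)
  then have "?M ** matrix_inv ?M = mat 1"
    unfolding matrix_inv_def invertible_def by (rule someI2_ex) simp
  then show ?thesis by (simp add: LM_matrix_def matrix_mul_assoc)
qed

lemma LM_matrix_entry: "LM_matrix \<T> \<Omega> \<phi> $ i $ j = stiffness_matrix \<Omega> \<phi> $ i $ j / lumped_mass i"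
proof -
  have "stiffness_matrix \<Omega> \<phi> $ i $ j = lumped_mass i * LM_matrix \<T> \<Omega> \<phi> $ i $ j"
    unfolding LM_matrix_mult[symmetric]
    by (simp add: matrix_matrix_mult_def lumped_mass_matrix_entry if_distrib[of "\<lambda>x. x * _"] cong: if_cong)
  then show ?thesis using lumped_mass_pos[of i] by simp
qed

text \<open>The quadratic form is the Dirichlet energy of \<open>w\<close>, the combination of basis
  functions with coefficients \<open>x\<close>, and \<open>G K\<close> is its gradient on
  \<open>K\<close>. Zero energy makes \<open>w\<close> constant on each triangle; being continuous
  with finitely many values on a connected set, it is constant, and it vanishes on the nonempty
  frontier.\<close>

lemma stiffness_positive_definite:
  assumes "x \<bullet> (stiffness_matrix \<Omega> \<phi> *v x) \<le> 0"
  shows "x = 0"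
proof -
  define G where "G = (\<lambda>K. \<Sum>i\<in>UNIV. x $ i *\<^sub>R grad K i)"
  have "x \<bullet> (stiffness_matrix \<Omega> \<phi> *v x) =
      (\<Sum>i\<in>UNIV. \<Sum>j\<in>UNIV. \<Sum>K\<in>\<T>. measure lebesgue K * (x $ i * x $ j * (grad K j \<bullet> grad K i)))"
    by (simp add: inner_vec_def matrix_vector_mult_def stiffness_entry sum_distrib_left
        sum_distrib_right mult_ac)
  also have "\<dots> = (\<Sum>K\<in>\<T>. \<Sum>i\<in>UNIV. \<Sum>j\<in>UNIV. measure lebesgue K * (x $ i * x $ j * (grad K j \<bullet> grad K i)))"
    by (subst sum.swap[of _ _ \<T>], rule sum.cong[OF refl], subst sum.swap[of _ _ \<T>]) simp
  also have "\<dots> = (\<Sum>K\<in>\<T>. measure lebesgue K * (G K \<bullet> G K))"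
    by (simp add: G_def inner_sum_left inner_sum_right sum_distrib_left inner_commute mult_ac)
  finally have "(\<Sum>K\<in>\<T>. measure lebesgue K * (G K \<bullet> G K)) \<le> 0" using assms by simp
  moreover have nn: "measure lebesgue K * (G K \<bullet> G K) \<ge> 0" for K by simp
  ultimately have "(\<Sum>K\<in>\<T>. measure lebesgue K * (G K \<bullet> G K)) = 0"
    using sum_nonneg[of \<T> "\<lambda>K. measure lebesgue K * (G K \<bullet> G K)"] by simp
  then have "\<forall>K\<in>\<T>. measure lebesgue K * (G K \<bullet> G K) = 0"
    using sum_nonneg_eq_0_iff[OF finite_mesh, of "\<lambda>K. measure lebesgue K * (G K \<bullet> G K)"] nn by blast
  then have G0: "G K = 0" if "K \<in> \<T>" for K
    using that measure_mesh_pos[OF that] by fastforce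
  define w where "w = (\<lambda>y. \<Sum>i\<in>UNIV. x $ i * \<phi> i y)"
  have "\<exists>k. \<forall>y\<in>K. w y = k" if K: "K \<in> \<T>" for K
  proof -
    have "\<forall>i. \<exists>k. \<forall>y\<in>K. \<phi> i y = grad K i \<bullet> y + k"
      using basis_affine[OF K] by metis
    then obtain k where k: "\<And>i y. y \<in> K \<Longrightarrow> \<phi> i y = grad K i \<bullet> y + k i" by metis
    have "w y = G K \<bullet> y + (\<Sum>i\<in>UNIV. x $ i * k i)" if "y \<in> K" for y
      by (simp add: w_def k[OF that] G_def inner_sum_left sum.distrib algebra_simps)
    then show ?thesis using G0[OF K] by auto
  qed
  then obtain k where k: "\<And>K y. K \<in> \<T> \<Longrightarrow> y \<in> K \<Longrightarrow> w y = k K" by metis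
  have "w ` closure \<Omega> \<subseteq> k ` \<T>" using k Union_mesh by (auto simp: image_iff) blast
  then have fin: "finite (w ` closure \<Omega>)" using finite_mesh finite_surj by blast
  have conn: "connected (closure \<Omega>)" using domain by (auto simp: polygonal_domain_def connected_imp_connected_closure)
  have cont: "continuous_on (closure \<Omega>) w" unfolding w_def
    by (intro continuous_intros continuous_on_basis)
  obtain r where r: "\<And>y. y \<in> closure \<Omega> \<Longrightarrow> w y = r"
    using continuous_finite_range_constant[OF conn cont fin] by (auto simp: constant_on_def)
  have "\<Omega> \<noteq> {}" "bounded \<Omega>" using domain by (simp_all add: polygonal_domain_def)
  moreover from this have "\<Omega> \<noteq> UNIV" using not_bounded_UNIV by metis
  ultimately have "frontier \<Omega> \<noteq> {}" by (intro frontier_not_empty)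
  then obtain z where z: "z \<in> frontier \<Omega>" by auto
  then have "w z = 0" by (simp add: w_def basis_frontier)
  then have r0: "r = 0" using r[of z] z by (simp add: frontier_def)
  have "x $ i = 0" for i
  proof -
    have "w (P i) = x $ i"
      by (simp add: w_def basis_node if_distrib[of "(*) _"] cong: if_cong)
    then show ?thesis using r[of "P i"] r0 P_domain[of i] closure_subset[of \<Omega>] by auto
  qed
  then show ?thesis by (simp add: vec_eq_iff)
qed

section \<open>Cotangent formula and the Delaunay condition\<close>

text \<open>The right side is minus half the cotangent of the angle at \<open>c\<close>: the area of
  the triangle times the product of two dual basis vectors.\<close>

lemma element_stiffness:
  assumes K: "convex hull {P i, P j, c} \<in> \<T>"
  shows "measure lebesgue (convex hull {P i, P j, c}) *
      (grad (convex hull {P i, P j, c}) j \<bullet> grad (convex hull {P i, P j, c}) i) =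
    - ((P i - c) \<bullet> (P j - c) / \<bar>area2 (P i) (P j) c\<bar>) / 2"
proof -
  let ?K = "convex hull {P i, P j, c}"
  note vK = vertices_triangle[OF simplex_mesh[OF K]]
  obtain k where k: "\<And>x. x \<in> ?K \<Longrightarrow> \<phi> i x = grad ?K i \<bullet> x + k"
    using basis_affine[OF K] by blast
  obtain l where l: "\<And>x. x \<in> ?K \<Longrightarrow> \<phi> j x = grad ?K j \<bullet> x + l"
    using basis_affine[OF K] by blast
  have "v \<in> {P i, P j, c} \<Longrightarrow> grad ?K i \<bullet> v + k = (if v = P i then 1 else 0)"
    "v \<in> {P i, P j, c} \<Longrightarrow> grad ?K j \<bullet> v + l = (if v = P j then 1 else 0)" for v
    using k[of v] l[of v] basis_vertex[OF K, of v] vK(1) by (auto simp: hull_inc)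
  then have "grad ?K i \<bullet> grad ?K j * (area2 (P i) (P j) c)\<^sup>2 = - ((P i - c) \<bullet> (P j - c))"
    using vK(3-5) by (intro inner_triangle_gradients[where k = k and l = l]) auto
  then have "grad ?K j \<bullet> grad ?K i = - ((P i - c) \<bullet> (P j - c)) / \<bar>area2 (P i) (P j) c\<bar>\<^sup>2"
    using vK(6) by (simp add: inner_commute field_simps)
  then show ?thesis
    using vK(6) by (simp add: measure_triangle power2_eq_square field_simps)
qed

text \<open>A triangle without one of the two nodes contributes nothing, as one gradient is 0 there.
  The two remaining triangles, distinct by \<open>ne\<close>, contribute one cotangent each.\<close>

lemma stiffness_entry_edge:
  assumes patch: "{K\<in>\<T>. P i \<in> vertices K \<and> P j \<in> vertices K} =
      {convex hull {P i, P j, c}, convex hull {P i, P j, d}}"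
    and ne: "convex hull {P i, P j, c} \<noteq> convex hull {P i, P j, d}"
  shows "stiffness_matrix \<Omega> \<phi> $ i $ j \<le> 0 \<longleftrightarrow> angle (P i) c (P j) + angle (P i) d (P j) \<le> pi"
proof -
  have K: "convex hull {P i, P j, c} \<in> \<T>" "convex hull {P i, P j, d} \<in> \<T>"
    using patch by blast+
  have "stiffness_matrix \<Omega> \<phi> $ i $ j =
      (\<Sum>K\<in>{K\<in>\<T>. P i \<in> vertices K \<and> P j \<in> vertices K}. measure lebesgue K * (grad K j \<bullet> grad K i))"
    unfolding stiffness_entry
    by (intro sum.mono_neutral_right finite_mesh)
      (auto, (metis grad_eq_0 inner_zero_left inner_zero_right)+)
  also have "\<dots> = - ((P i - c) \<bullet> (P j - c) / \<bar>area2 (P i) (P j) c\<bar>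
      + (P i - d) \<bullet> (P j - d) / \<bar>area2 (P i) (P j) d\<bar>) / 2"
    unfolding patch using ne by (simp add: element_stiffness[OF K(1)] element_stiffness[OF K(2)])
  finally have S: "stiffness_matrix \<Omega> \<phi> $ i $ j = - ((P i - c) \<bullet> (P j - c) / \<bar>area2 (P i) (P j) c\<bar>
      + (P i - d) \<bullet> (P j - d) / \<bar>area2 (P i) (P j) d\<bar>) / 2" .
  have "- z / 2 \<le> 0 \<longleftrightarrow> z \<ge> 0" for z :: real by simp
  then show ?thesis
    unfolding S angle_sum_le_pi_iff[OF K[THEN simplex_mesh, THEN vertices_triangle(6)]] .
qed

text \<open>Two distinct nodes either share no triangle, and the entry is 0, or span an interior
  edge. Conversely both endpoints of an interior edge are nodes, so every such edge is tested by an
  entry.\<close>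

lemma stiffness_offdiagonal_nonpos_iff_Delaunay:
  "(\<forall>i j. i \<noteq> j \<longrightarrow> stiffness_matrix \<Omega> \<phi> $ i $ j \<le> 0) \<longleftrightarrow> Delaunay \<T> \<Omega>"
proof (intro iffI allI impI)
  assume D: "Delaunay \<T> \<Omega>"
  fix i j :: 'n assume ij: "i \<noteq> j"
  show "stiffness_matrix \<Omega> \<phi> $ i $ j \<le> 0"
  proof (cases "\<exists>K\<in>\<T>. P i \<in> vertices K \<and> P j \<in> vertices K")
    case True
    then obtain K where K: "K \<in> \<T>" "P i \<in> vertices K" "P j \<in> vertices K" by blast
    then obtain c where c: "convex hull {P i, P j, c} \<in> \<T>"
      using triangle_with_edge[OF simplex_mesh[OF K(1)]] ij P_inj by metis
    obtain d where d: "convex hull {P i, P j, d} \<in> \<T>" "c \<noteq> d"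
      "convex hull {P i, P j, c} \<noteq> convex hull {P i, P j, d}" "closed_segment (P i) (P j) \<subseteq> \<Omega>"
      "{K\<in>\<T>. P i \<in> vertices K \<and> P j \<in> vertices K} =
        {convex hull {P i, P j, c}, convex hull {P i, P j, d}}"
      using mesh_edge_patch[OF c P_domain P_domain] .
    have "Delaunay_edge \<T> (closed_segment (P i) (P j))"
      using D interior_edge_triangle[OF c d(4)] by (simp add: Delaunay_def)
    then have "angle (P i) c (P j) + angle (P i) d (P j) \<le> pi"
      using c d(1,2) unfolding Delaunay_edge_def by blast
    then show ?thesis using stiffness_entry_edge[OF d(5,3)] by simp
  next
    case False
    then have "grad K j \<bullet> grad K i = 0" if "K \<in> \<T>" for K
      using that grad_eq_0[OF that, of i] grad_eq_0[OF that, of j] by auto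
    then show ?thesis by (simp add: stiffness_entry)
  qed
next
  assume S: "\<forall>i j. i \<noteq> j \<longrightarrow> stiffness_matrix \<Omega> \<phi> $ i $ j \<le> 0"
  have angles: "angle a c b + angle a d b \<le> pi"
    if e: "closed_segment a b \<subseteq> \<Omega>" and cd: "c \<noteq> d"
      and K: "convex hull {a, b, c} \<in> \<T>" "convex hull {a, b, d} \<in> \<T>" for a b c d
  proof -
    note vK = vertices_triangle[OF simplex_mesh[OF K(1)]]
    note vK' = vertices_triangle[OF simplex_mesh[OF K(2)]]
    have ab: "a \<in> \<Omega>" "b \<in> \<Omega>" using e by auto
    then have "a \<in> range P" "b \<in> range P" unfolding P_range using K(1) vK(1) by auto
    then obtain i j where ij: "a = P i" "b = P j" by auto
    have ne: "convex hull {a, b, c} \<noteq> convex hull {a, b, d}"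
      using vK(1,4,5) vK'(1) cd by (metis insert_iff singletonD)
    \<comment> \<open>The patch has exactly two triangles, so the one with third vertex
      \<open>d\<close> must be the second.\<close>
    obtain d' where "{K\<in>\<T>. a \<in> vertices K \<and> b \<in> vertices K} =
        {convex hull {a, b, c}, convex hull {a, b, d'}}"
      using mesh_edge_patch[OF K(1) ab] .
    moreover have "convex hull {a, b, d} \<in> {K\<in>\<T>. a \<in> vertices K \<and> b \<in> vertices K}"
      using K(2) vK'(1) by simp
    ultimately have patch: "{K\<in>\<T>. a \<in> vertices K \<and> b \<in> vertices K} =
        {convex hull {a, b, c}, convex hull {a, b, d}}"
      using ne by auto
    have "i \<noteq> j" using vK(3) ij by auto
    then have "stiffness_matrix \<Omega> \<phi> $ i $ j \<le> 0" using S by simp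
    then show ?thesis
      using stiffness_entry_edge[OF patch[unfolded ij] ne[unfolded ij]] by (simp add: ij)
  qed
  show "Delaunay \<T> \<Omega>"
    unfolding Delaunay_def Delaunay_edge_def
  proof (intro ballI allI impI)
    fix e a b c d
    assume "e \<in> interior_edges \<T> \<Omega>" and "e = closed_segment a b \<and> c \<noteq> d \<and>
      convex hull {a, b, c} \<in> \<T> \<and> convex hull {a, b, d} \<in> \<T>"
    then show "angle a c b + angle a d b \<le> pi"
      using angles[of a b c d] by (simp add: interior_edges_def)
  qed
qed

lemma LM_matrix_offdiagonal_nonpos_iff_Delaunay:
  "(\<forall>i j. i \<noteq> j \<longrightarrow> LM_matrix \<T> \<Omega> \<phi> $ i $ j \<le> 0) \<longleftrightarrow> Delaunay \<T> \<Omega>"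
proof -
  have "LM_matrix \<T> \<Omega> \<phi> $ i $ j \<le> 0 \<longleftrightarrow> stiffness_matrix \<Omega> \<phi> $ i $ j \<le> 0" for i j
    using lumped_mass_pos[of i] by (simp add: LM_matrix_entry divide_le_0_iff)
  then show ?thesis by (simp add: stiffness_offdiagonal_nonpos_iff_Delaunay)
qed

end

section \<open>Nonnegativity of the solution matrix\<close>

theorem theorem3p3:
  fixes \<Omega> :: "(real^2) set"
    and \<FF> :: "(real^2) set set set"
    and \<T> :: "(real^2) set set"
    and P :: "'n::finite \<Rightarrow> real^2"
    and \<phi> :: "'n \<Rightarrow> real^2 \<Rightarrow> real"
    and \<nu> :: "real measure"
    and E :: "real \<Rightarrow> real^'n^'n"
  assumes "polygonal_domain \<Omega>"
    and "\<And>\<T>'. \<T>' \<in> \<FF> \<Longrightarrow> triangulates \<T>' \<Omega>"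
    and "shape_regular_quasi_uniform \<FF>"
    and "\<T> \<in> \<FF>"
    and "bij_betw P UNIV (interior_nodes \<T> \<Omega>)"
    and "nodal_basis \<T> \<Omega> P \<phi>"
    and "case_I \<nu> \<or> case_II \<nu>"
    and "solution_matrix \<nu> (LM_matrix \<T> \<Omega> \<phi>) E"
  shows "(\<forall>t\<ge>0. \<forall>i j. E t $ i $ j \<ge> 0) \<longleftrightarrow> Delaunay \<T> \<Omega>"
proof -
  interpret lumped_mass_method \<Omega> \<T> P \<phi>
    using assms by unfold_locales auto
  let ?H = "LM_matrix \<T> \<Omega> \<phi>"
  have \<nu>: "space \<nu> \<subseteq> {0..1}" using assms(7) space_case_I space_case_II by blast
  have sol: "solves_ivp \<nu> ?H (axis j 1) (\<lambda>t. E t *v axis j 1)" for j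
    using assms(8) by (simp add: solution_matrix_def)
  have col: "(E t *v axis j 1) $ i = E t $ i $ j" for t i j
    by (simp add: matrix_vector_mult_basis column_def)
  have "(\<forall>t\<ge>0. \<forall>i j. E t $ i $ j \<ge> 0) \<longleftrightarrow> (\<forall>i j. i \<noteq> j \<longrightarrow> ?H $ i $ j \<le> 0)"
  proof (intro iffI allI impI)
    fix i j :: 'n
    assume "\<forall>t\<ge>0. \<forall>i j. E t $ i $ j \<ge> 0" "i \<noteq> j"
    then show "?H $ i $ j \<le> 0"
      by (intro solves_ivp_unit_vector_nonneg_imp[OF \<nu> sol]) (auto simp: col)
  next
    fix t :: real and i j :: 'n
    assume Z: "\<forall>i j. i \<noteq> j \<longrightarrow> ?H $ i $ j \<le> 0" and t: "t \<ge> 0"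
    \<comment> \<open>The sign conditions on both matrices are equivalent to the Delaunay property,
      so they transfer.\<close>
    have "stiffness_matrix \<Omega> \<phi> $ i $ k \<le> 0" if "i \<noteq> k" for i k
      using Z that LM_matrix_offdiagonal_nonpos_iff_Delaunay
        stiffness_offdiagonal_nonpos_iff_Delaunay by blast
    then obtain w where w: "\<And>i. w $ i > 0" "stiffness_matrix \<Omega> \<phi> *v w = 1"
      using Stieltjes_matrix_positive_vector[OF stiffness_positive_definite] by metis
    \<comment> \<open>Division by the lumped masses turns \<open>S *v w = 1\<close> into a positive
      vector \<open>?H *v w\<close>, as the comparison argument requires.\<close>
    have "(?H *v w) $ k = (stiffness_matrix \<Omega> \<phi> *v w) $ k / lumped_mass k" for k
      by (simp add: matrix_vector_mult_def LM_matrix_entry sum_divide_distrib)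
    then have "(?H *v w) $ k > 0" for k using lumped_mass_pos by (simp add: w)
    then have "(E t *v axis j 1) $ i \<ge> 0"
      using Z w(1) t by (intro solves_ivp_nonneg[OF \<nu> sol, where w = w]) (auto simp: axis_def)
    then show "E t $ i $ j \<ge> 0" by (simp add: col)
  qed
  then show ?thesis by (simp add: LM_matrix_offdiagonal_nonpos_iff_Delaunay)
qed

end
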